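(* Let $G$ be a finite abelian group, written additively, and let $S$ be a generating subset of $G$ such that $0 \not\in S$ and $|S| \geq 5$. Then $|\Sigma S| \geq \min(|G|, 2|S|)$.
   Context: For a subset $A$ of an additively written finite abelian group $G$, $\Sigma A$ denotes the set of all nonempty subset sums of $A$: $\Sigma A = \{ \sum_{b \in B} b \mid \emptyset \neq B \subseteq A\}$. A subset $S$ of $G$ is generating if the subgroup of $G$ generated by $S$ is $G$ itself. *)

theory Defs
  imports Complex_Main "HOL-Computational_Algebra.Group_Closure"
begin

definition nonempty_subset_sums :: "'a::ab_group_add set \<Rightarrow> 'a set" where
  "nonempty_subset_sums A = {\<Sum>b\<in>B. b | B. B \<noteq> {} \<and> B \<subseteq> A}"

text \<open>The set \<^term>\<open>group_closure S\<close> is the subgroup generated by \<^term>\<open>S\<close>: it is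
  the least set containing \<^term>\<open>S\<close> and \<^term>\<open>0\<close> that is closed under subtraction.\<close>

definition generating :: "'a::ab_group_add set \<Rightarrow> bool" where
  "generating S \<longleftrightarrow> group_closure S = UNIV"

end

theory Submission
  imports Defs
begin

text \<open>
  Let \<open>\<Sigma>\<close> be the set of all subset sums of \<open>S\<close>, the empty sum included, and \<open>H\<close> the subgroup
  generated by \<open>S\<close>. The main part of the proof shows \<open>|\<Sigma>| \<ge> min(|H|, 2|S|)\<close>
  (\<open>card_subset_sums_ge\<close>) by induction on \<open>|S|\<close>, following ideas of Olson.

  Call \<open>t \<in> \<Sigma>\<close> an exit in direction \<open>x\<close> if \<open>t + x \<notin> \<Sigma>\<close>. Removing \<open>x\<close> from \<open>S\<close> destroys at least as
  many sums as there are exits in direction \<open>x\<close> (\<open>card_subset_sums_remove\<close>), so one direction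
  with two exits is enough for the induction step. If every element of \<open>S\<close> has at most one
  exit, then \<open>\<Sigma>\<close> is all of \<open>H\<close> or misses a single element (\<open>card_closure_le_if_few_exits\<close>), which
  is more than needed when \<open>|H| > 2|S|\<close>.

  If \<open>|H| \<le> 2|S|\<close>, one has to reach all of \<open>H\<close>. By the pigeonhole principle it suffices to split \<open>S\<close> into
  \<open>U\<close> and \<open>V\<close> whose numbers of sums add up to more than \<open>|H|\<close>. A triple \<open>U\<close> without two
  coincidences among its sums has seven of them, one more than \<open>2|U|\<close>, so \<open>V\<close> needs only \<open>2|V|\<close>
  sums. For \<open>|S| \<ge> 8\<close> these are provided by induction (or the sums of \<open>V\<close> form a subgroup); for \<open>|S|\<close> equal to 5, 6, 7
  the set \<open>V\<close> is a pair, triple or quadruple, and the few configurations with too few sums are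
  avoided by choosing another split. The bound on quadruples (\<open>card_subset_sums_quadruple\<close>) also
  starts the induction.

  It remains to discard the empty sum. If \<open>0\<close> is a nonempty sum, nothing changes. Otherwise \<open>S\<close> is
  zero-sum free and one more sum is needed. Then the Kemperman--Scherk inequality makes the
  numbers of sums of disjoint parts almost additive, and five elements always contain a triple
  with eight distinct sums (\<open>zero_sum_free_dissociated_triple\<close>), which gives \<open>|\<Sigma>| \<ge> 2|S| + 1\<close>.
\<close>

section \<open>Subset sums\<close>

text \<open>The empty sum is counted here: with it the sums of a disjoint union are exactly the sums
  \<open>u + v\<close> of a sum from each part, and replacing an element \<open>x\<close> by \<open>- x\<close> merely translates
  the set of sums.\<close>

definition subset_sums :: "'a::ab_group_add set \<Rightarrow> 'a set" where
  "subset_sums A = {\<Sum>b\<in>B. b | B. B \<subseteq> A}"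

lemma zero_in_subset_sums [simp]: "0 \<in> subset_sums A"
  unfolding subset_sums_def by (auto intro!: exI[of _ "{}"])

lemma subset_sums_empty [simp]: "subset_sums {} = {0}"
  by (auto simp: subset_sums_def)

lemma subset_sums_mono: "A \<subseteq> B \<Longrightarrow> subset_sums A \<subseteq> subset_sums B"
  by (auto simp: subset_sums_def)

lemma elem_in_subset_sums: "x \<in> A \<Longrightarrow> x \<in> subset_sums A"
  unfolding subset_sums_def by (auto intro!: exI[of _ "{x}"])

lemma subset_sums_Un:
  fixes U V :: "'a::{ab_group_add, finite} set"
  assumes "U \<inter> V = {}"
  shows "t \<in> subset_sums (U \<union> V) \<longleftrightarrow> (\<exists>u\<in>subset_sums U. \<exists>v\<in>subset_sums V. t = u + v)"
proof
  assume "t \<in> subset_sums (U \<union> V)"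
  then obtain B where B: "B \<subseteq> U \<union> V" "t = \<Sum>B" by (auto simp: subset_sums_def)
  have "B = (B \<inter> U) \<union> (B \<inter> V)" using B by auto
  then have "t = \<Sum>(B \<inter> U) + \<Sum>(B \<inter> V)"
    using assms B(2) by (subst (asm) B(2), subst sum.union_disjoint[symmetric]) auto
  then show "\<exists>u\<in>subset_sums U. \<exists>v\<in>subset_sums V. t = u + v"
    unfolding subset_sums_def by blast
next
  assume "\<exists>u\<in>subset_sums U. \<exists>v\<in>subset_sums V. t = u + v"
  then obtain B C where B: "B \<subseteq> U" "C \<subseteq> V" "t = \<Sum>B + \<Sum>C"
    by (auto simp: subset_sums_def)
  then have "t = \<Sum>(B \<union> C)" using assms by (subst sum.union_disjoint) auto
  then show "t \<in> subset_sums (U \<union> V)" using B by (auto simp: subset_sums_def)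
qed

lemma subset_sums_insert:
  fixes A :: "'a::{ab_group_add, finite} set"
  assumes "x \<notin> A"
  shows "subset_sums (insert x A) = subset_sums A \<union> (+) x ` subset_sums A"
proof -
  have [simp]: "subset_sums {x} = {0, x}"
  proof -
    have "subset_sums {x} = {\<Sum>B | B. B = {} \<or> B = {x}}"
      by (simp add: subset_sums_def subset_singleton_iff)
    also have "\<dots> = {\<Sum>{}, \<Sum>{x}}" by blast
    finally show ?thesis by simp
  qed
  show ?thesis
    using subset_sums_Un[of "{x}" A] assms by auto
qed

lemma subset_sums_subset_closure:
  fixes A :: "'a::{ab_group_add, finite} set"
  shows "subset_sums A \<subseteq> group_closure A"
proof
  fix t assume "t \<in> subset_sums A"
  then obtain B where "B \<subseteq> A" and t: "t = \<Sum>B" by (auto simp: subset_sums_def)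
  have "finite B" by simp
  then have "B \<subseteq> A \<longrightarrow> \<Sum>B \<in> group_closure A"
    by induction (auto intro: group_closure_add group_closure.base)
  with \<open>B \<subseteq> A\<close> t show "t \<in> group_closure A" by simp
qed

section \<open>Sets closed under translations\<close>

lemma subset_closure: "A \<subseteq> group_closure A"
  by (auto intro: group_closure.base)

lemma group_closure_least:
  assumes "A \<subseteq> group_closure B"
  shows "group_closure A \<subseteq> group_closure B"
proof
  fix t assume "t \<in> group_closure A"
  then show "t \<in> group_closure B"
    by induction (use assms in \<open>auto intro: group_closure.diff\<close>)
qed

lemma card_less_card_subset_sums:
  fixes S :: "'a::{ab_group_add, finite} set"
  assumes "0 \<notin> S"
  shows "card S + 1 \<le> card (subset_sums S)"
proof -
  have "card (insert 0 S) \<le> card (subset_sums S)"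
    by (rule card_mono) (auto intro: elem_in_subset_sums)
  then show ?thesis using assms by simp
qed

text \<open>Translation by \<open>h\<close> is injective, so on a finite set it is onto as soon as it maps the set
  into itself. This is why closure under adding the elements of \<open>S\<close> suffices for invariance
  under the whole subgroup generated by \<open>S\<close>.\<close>

lemma diff_mem_if_translation_closed:
  fixes X :: "'a::{ab_group_add, finite} set"
  assumes "\<And>t. t \<in> X \<Longrightarrow> t + h \<in> X" and "t \<in> X"
  shows "t - h \<in> X"
proof -
  have "(\<lambda>t. t + h) ` X = X"
    by (rule card_seteq) (use assms in \<open>auto simp: card_image inj_on_def\<close>)
  with assms(2) obtain s where "s \<in> X" "t = s + h" by blast
  then show ?thesis by simp
qed

lemma closed_imp_periodic:
  fixes X :: "'a::{ab_group_add, finite} set"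
  assumes "\<And>x t. x \<in> S \<Longrightarrow> t \<in> X \<Longrightarrow> t + x \<in> X"
    and "h \<in> group_closure S" "t \<in> X"
  shows "t + h \<in> X"
  using assms(2,3)
proof (induction arbitrary: t)
  case (base s)
  then show ?case using assms(1) by auto
next
  case (diff s u)
  have "(t - u) + s \<in> X"
    by (intro diff.IH(1) diff_mem_if_translation_closed[of X u]) (use diff in auto)
  then show ?case by (simp add: algebra_simps)
qed

lemma closed_contains_closure:
  fixes X :: "'a::{ab_group_add, finite} set"
  assumes "\<And>x t. x \<in> S \<Longrightarrow> t \<in> X \<Longrightarrow> t + x \<in> X" "0 \<in> X"
  shows "group_closure S \<subseteq> X"
  using closed_imp_periodic[of S X _ 0] assms by auto

lemma card_closure_le_if_closed:
  fixes X :: "'a::{ab_group_add, finite} set"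
  assumes "\<And>x t. x \<in> S \<Longrightarrow> t \<in> X \<Longrightarrow> t + x \<in> X" "X \<noteq> {}"
  shows "card (group_closure S) \<le> card X"
proof -
  obtain t where "t \<in> X" using assms by blast
  then have "(+) t ` group_closure S \<subseteq> X"
    using closed_imp_periodic[of S X] assms by blast
  then have "card ((+) t ` group_closure S) \<le> card X" by (simp add: card_mono)
  then show ?thesis by (simp add: card_image)
qed

text \<open>A set invariant under a subgroup is a union of its cosets.\<close>

lemma card_closure_dvd_if_closed:
  fixes X :: "'a::{ab_group_add, finite} set"
  assumes closed: "\<And>x t. x \<in> S \<Longrightarrow> t \<in> X \<Longrightarrow> t + x \<in> X"
  shows "card (group_closure S) dvd card X"
proof -
  let ?K = "group_closure S"
  let ?r = "{(s, t). s \<in> X \<and> t \<in> X \<and> t - s \<in> ?K}"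
  have eq: "equiv X ?r"
  proof (rule equivI)
    show "?r \<subseteq> X \<times> X" by auto
    show "refl_on X ?r" by (auto simp: refl_on_def)
    show "sym ?r"
    proof (rule symI)
      fix u v assume "(u, v) \<in> ?r"
      then show "(v, u) \<in> ?r" using group_closure_minus_iff[of "v - u" S] by auto
    qed
    show "trans ?r"
    proof (rule transI)
      fix u v w assume "(u, v) \<in> ?r" "(v, w) \<in> ?r"
      then show "(u, w) \<in> ?r" using group_closure_add[of "v - u" S "w - v"] by auto
    qed
  qed
  show ?thesis
  proof (rule equiv_imp_dvd_card[OF _ eq])
    fix Y assume "Y \<in> X // ?r"
    then obtain s where s: "s \<in> X" "Y = ?r `` {s}" by (auto elim: quotientE)
    have "Y = (+) s ` ?K"
    proof
      show "Y \<subseteq> (+) s ` ?K" 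
      proof
        fix t assume "t \<in> Y"
        then have "t - s \<in> ?K" using s by auto
        moreover have "t = s + (t - s)" by simp
        ultimately show "t \<in> (+) s ` ?K" by blast
      qed
      show "(+) s ` ?K \<subseteq> Y"
        using s closed_imp_periodic[of S X] closed by auto
    qed
    then show "card ?K dvd card Y" by (simp add: card_image)
  qed simp
qed

section \<open>Exits in a direction\<close>

text \<open>The number of exits is Olson's \<open>\<lambda>\<^sub>B(x) = |(B + x) - B|\<close>; it measures how far \<open>B\<close> is from being
  invariant under \<open>x\<close>.\<close>

definition exits :: "'a::ab_group_add set \<Rightarrow> 'a \<Rightarrow> 'a set" where
  "exits B x = {t \<in> B. t + x \<notin> B}"

text \<open>With \<open>C\<close> the sums that avoid \<open>x\<close>, all sums form \<open>C \<union> (x + C)\<close>. An element of \<open>C\<close> is never an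
  exit of this union in direction \<open>x\<close>, so every exit is a sum that is lost when \<open>x\<close> is
  removed. This is the engine of the induction on the size of \<open>S\<close>.\<close>

lemma card_subset_sums_remove:
  fixes S :: "'a::{ab_group_add, finite} set"
  assumes "x \<in> S"
  shows "card (subset_sums (S - {x})) + card (exits (subset_sums S) x) \<le> card (subset_sums S)"
proof -
  let ?C = "subset_sums (S - {x})" and ?B = "subset_sums S"
  have B: "?B = ?C \<union> (+) x ` ?C"
    using subset_sums_insert[of x "S - {x}"] assms by (simp add: insert_absorb)
  have "exits ?B x \<inter> ?C = {}"
    using B by (auto simp: exits_def add.commute)
  then have "card (?C \<union> exits ?B x) = card ?C + card (exits ?B x)"
    by (subst card_Un_disjoint) auto
  moreover have "card (?C \<union> exits ?B x) \<le> card ?B"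
    by (rule card_mono) (use B in \<open>auto simp: exits_def\<close>)
  ultimately show ?thesis by simp
qed

lemma card_subset_sums_outside:
  fixes S :: "'a::{ab_group_add, finite} set"
  assumes "x \<in> S" "x \<notin> group_closure (S - {x})"
  shows "card (subset_sums S) = 2 * card (subset_sums (S - {x}))"
proof -
  let ?C = "subset_sums (S - {x})" and ?K = "group_closure (S - {x})"
  have B: "subset_sums S = ?C \<union> (+) x ` ?C"
    using subset_sums_insert[of x "S - {x}"] assms by (simp add: insert_absorb)
  have "?C \<inter> (+) x ` ?C = {}"
  proof (rule ccontr)
    assume "\<not> ?thesis"
    then obtain s t where "s \<in> ?C" "t \<in> ?C" "s = x + t" by blast
    then have "s - t \<in> ?K" using subset_sums_subset_closure group_closure.diff by blast
    then show False using \<open>s = x + t\<close> assms by simp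
  qed
  then show ?thesis using B by (simp add: card_Un_disjoint card_image)
qed

text \<open>Pigeonhole: for \<open>g\<close> in the subgroup, the sets \<open>g - A\<close> and \<open>C\<close> are too large to be disjoint,
  and a common element writes \<open>g\<close> as \<open>u + v\<close>.\<close>

lemma subset_sums_Un_eq_closure:
  fixes S :: "'a::{ab_group_add, finite} set"
  assumes A: "A \<subseteq> group_closure S" and C: "C \<subseteq> group_closure S"
    and sub: "\<And>u v. u \<in> A \<Longrightarrow> v \<in> C \<Longrightarrow> u + v \<in> subset_sums S"
    and "card (group_closure S) < card A + card C"
  shows "subset_sums S = group_closure S"
proof
  show "group_closure S \<subseteq> subset_sums S"
  proof
    fix g assume g: "g \<in> group_closure S"
    let ?A = "(\<lambda>u. g - u) ` A"
    have "?A \<inter> C \<noteq> {}"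
    proof
      assume "?A \<inter> C = {}"
      then have "card (?A \<union> C) = card A + card C"
        by (subst card_Un_disjoint) (auto simp: card_image inj_on_def)
      moreover have "card (?A \<union> C) \<le> card (group_closure S)"
        by (rule card_mono) (use A C g in \<open>auto intro!: group_closure.diff\<close>)
      ultimately show False using assms(4) by simp
    qed
    then obtain u v where "u \<in> A" "v \<in> C" "g - u = v" by blast
    then show "g \<in> subset_sums S" using sub[of u v] by (simp add: algebra_simps)
  qed
qed (rule subset_sums_subset_closure)

lemma exit_unique:
  fixes B :: "'a::{ab_group_add, finite} set"
  assumes "card (exits B x) \<le> 1" "s \<in> B" "s + x \<notin> B" "t \<in> B" "t + x \<notin> B"
  shows "s = t"
proof -
  have "s \<in> exits B x" "t \<in> exits B x" using assms by (auto simp: exits_def)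
  then show ?thesis using assms(1) by (metis card_le_Suc0_iff_eq finite One_nat_def)
qed

lemma card_exits_uminus:
  fixes B :: "'a::{ab_group_add, finite} set"
  shows "card (exits B (- x)) = card (exits B x)"
proof -
  let ?f = "\<lambda>t. t + x"
  have "card (B \<inter> ?f ` B) + card (exits B (-x)) = card B"
  proof -
    have "B = (B \<inter> ?f ` B) \<union> exits B (-x)"
      unfolding exits_def by (auto simp: image_iff) (metis add.commute diff_add_cancel)
    moreover have "(B \<inter> ?f ` B) \<inter> exits B (-x) = {}" by (auto simp: exits_def)
    ultimately show ?thesis by (metis card_Un_disjoint finite)
  qed
  moreover have "card (B \<inter> ?f ` B) + card (exits B x) = card (?f ` B)"
  proof -
    have "?f ` B = (B \<inter> ?f ` B) \<union> ?f ` exits B x" by (auto simp: exits_def)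
    moreover have "(B \<inter> ?f ` B) \<inter> ?f ` exits B x = {}" by (auto simp: exits_def)
    ultimately have "card (?f ` B) = card (B \<inter> ?f ` B) + card (?f ` exits B x)"
      by (metis card_Un_disjoint finite)
    then show ?thesis by (simp add: card_image inj_on_def)
  qed
  ultimately show ?thesis by (simp add: card_image inj_on_def)
qed

lemma card_exits_Compl:
  fixes B :: "'a::{ab_group_add, finite} set"
  shows "card (exits (- B) x) = card (exits B x)"
proof -
  have "exits B (- x) = (\<lambda>t. t + x) ` exits (- B) x"
    unfolding exits_def by (auto simp: image_iff) (metis diff_add_cancel)
  then have "card (exits B (- x)) = card (exits (- B) x)"
    by (simp add: card_image inj_on_def)
  then show ?thesis by (simp add: card_exits_uminus)
qed

section \<open>Sets with at most one exit in each direction\<close>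

text \<open>The point \<open>a\<close> is the only one of \<open>B\<close> that leaves \<open>B\<close> under \<open>x\<close>, and also the only one that
  leaves under \<open>- x\<close>; that is, \<open>B - {a}\<close> is invariant under \<open>x\<close> and \<open>a\<close> is an extra point. Applied
  to \<open>- B\<close> it says that \<open>B\<close> is invariant except for one missing point.\<close>

definition isolated :: "'a::ab_group_add set \<Rightarrow> 'a \<Rightarrow> 'a \<Rightarrow> bool" where
  "isolated B a x \<longleftrightarrow> a \<in> B \<and> (\<forall>t\<in>B. (t + x \<in> B \<longleftrightarrow> t \<noteq> a) \<and> (t - x \<in> B \<longleftrightarrow> t \<noteq> a))"

lemma isolated_uminus: "isolated B a (- x) \<longleftrightarrow> isolated B a x"
  by (auto simp: isolated_def)

lemma isolated_unique: "isolated B a x \<Longrightarrow> isolated B a' x \<Longrightarrow> a = a'"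
  by (auto simp: isolated_def)

lemma isolated_if_common_exit:
  fixes B :: "'a::{ab_group_add, finite} set"
  assumes x: "card (exits B x) \<le> 1" and y: "card (exits B y) \<le> 1"
    and a: "a \<in> B" "a + x \<notin> B" "a + y \<notin> B" and "x \<noteq> y"
  shows "isolated B a y"
proof -
  have "y \<noteq> 0" using a by auto
  have "a - y \<notin> B"
  proof
    assume 1: "a - y \<in> B"
    have "a - y + x \<in> B"
      using exit_unique[OF x a(1,2) 1] \<open>y \<noteq> 0\<close> by auto
    moreover have "a - y + x + y \<notin> B" using a by (simp add: algebra_simps)
    ultimately have "a = a - y + x" using exit_unique[OF y a(1,3)] by blast
    then show False using \<open>x \<noteq> y\<close> by (simp add: algebra_simps)
  qed
  moreover have "card (exits B (- y)) \<le> 1" using y by (simp add: card_exits_uminus)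
  ultimately show ?thesis
    unfolding isolated_def using a exit_unique[OF y] exit_unique[of B "- y"] by auto
qed

text \<open>A set with a single exit in direction \<open>x\<close> is a union of cosets of \<open>\<langle>x\<rangle>\<close> and one arithmetic
  progression with difference \<open>x\<close>. Two directions that are independent up to sign force this
  progression to be a single point or to miss only a single point of its coset, and the point
  is the same for both directions: otherwise following the exit of \<open>x\<close> around the
  parallelogram spanned by \<open>x\<close> and \<open>y\<close> closes up only if \<open>x + y = 0\<close>.\<close>

lemma isolated_common_point:
  fixes B :: "'a::{ab_group_add, finite} set"
  assumes x: "card (exits B x) = 1" and y: "card (exits B y) = 1"
    and "x \<noteq> y" "x \<noteq> - y"
  shows "(\<exists>a. isolated B a x \<and> isolated B a y) \<or> (\<exists>b. isolated (- B) b x \<and> isolated (- B) b y)"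
proof (rule ccontr)
  assume no: "\<not> ?thesis"
  have x': "card (exits (- B) x) = 1" and y': "card (exits (- B) y) = 1"
    using x y by (simp_all add: card_exits_Compl)
  \<comment> \<open>A point that exits in both directions would be the common isolated point of \<open>B\<close>, and dually for \<open>- B\<close>.\<close>
  have sep: False if "a \<in> B" "a + x \<notin> B" "a + y \<notin> B" for a
    using isolated_if_common_exit[of B x y a] isolated_if_common_exit[of B y x a] that x y no \<open>x \<noteq> y\<close> by auto
  have sep': False if "b \<notin> B" "b + x \<in> B" "b + y \<in> B" for b
    using isolated_if_common_exit[of "- B" x y b] isolated_if_common_exit[of "- B" y x b] that x' y' no \<open>x \<noteq> y\<close> by auto
  obtain a where a: "a \<in> B" "a + x \<notin> B" using x unfolding exits_def
    by (metis (mono_tags, lifting) card_1_singletonE insertI1 mem_Collect_eq)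
  have "y \<noteq> 0" "x \<noteq> 0" using x y by (auto simp: exits_def)
  have "a + y \<in> B" using sep a by blast
  then have "a + y + x \<in> B"
    using exit_unique[of B x a "a + y"] a x \<open>y \<noteq> 0\<close> by auto
  then have q: "a + x \<notin> B" "(a + x) + y \<in> B" using a by (simp_all add: algebra_simps)
  then have "a + x + x \<notin> B" using sep' by blast
  then have "a + x + x + y \<notin> B"
    using exit_unique[of "- B" y "a + x" "a + x + x"] q y' \<open>x \<noteq> 0\<close> by auto
  then have "(a + x + y) + x \<notin> B" by (simp add: algebra_simps)
  \<comment> \<open>The only exit of \<open>x\<close> is \<open>a\<close>, so the path from \<open>a\<close> over \<open>a + x\<close> to \<open>a + x + y\<close> has returned.\<close>
  then have "a = a + x + y" using exit_unique[of B x a "a + x + y"] a q x by auto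
  then show False using \<open>x \<noteq> - y\<close> by (simp add: algebra_simps add_eq_0_iff2)
qed

text \<open>Among any three pairwise independent directions, two of the three pairs agree on the kind of
  exceptional point (\<open>P\<close>: extra, \<open>Q\<close>: missing) and share a direction, so all three have the
  same point. The roles of \<open>P\<close> and \<open>Q\<close> are interchangeable, which is the reason for stating this
  for two abstract relations.\<close>

lemma common_point_extends:
  fixes P Q :: "'a::ab_group_add \<Rightarrow> 'a \<Rightarrow> bool"
  assumes xy: "x \<in> S" "y \<in> S" and P: "P a x" "P a y"
    and pair: "\<And>u v. u \<in> S \<Longrightarrow> v \<in> S \<Longrightarrow> u \<noteq> v \<Longrightarrow> u \<noteq> - v \<Longrightarrow>
        (\<exists>a. P a u \<and> P a v) \<or> (\<exists>b. Q b u \<and> Q b v)"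
    and uniqP: "\<And>a a' u. P a u \<Longrightarrow> P a' u \<Longrightarrow> a = a'"
    and uniqQ: "\<And>a a' u. Q a u \<Longrightarrow> Q a' u \<Longrightarrow> a = a'"
    and um: "\<And>a u. P a (- u) = P a u"
  shows "(\<forall>z\<in>S. P a z) \<or> (\<exists>b. \<forall>z\<in>S. Q b z)"
proof (cases "\<forall>z\<in>S. P a z")
  case False
  then obtain z where z: "z \<in> S" "\<not> P a z" by blast
  have switch: "\<exists>b. Q b u \<and> Q b w" if "u \<in> S" "w \<in> S" "\<not> P a u" "P a w" for u w
  proof -
    have "P a (- w)" using that um by simp
    then have "u \<noteq> w" "u \<noteq> - w" using that by auto
    then show ?thesis using pair[of u w] that uniqP[of _ w a] by blast
  qed
  obtain b where b: "Q b z" "Q b x" using switch[of z x] z xy P by blast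
  have "Q b w" if "w \<in> S" for w
  proof (cases "P a w")
    case True
    then show ?thesis using switch[of z w] z that uniqQ[OF b(1)] by blast
  next
    case False
    then show ?thesis using switch[of w x] xy P that uniqQ[OF b(2)] by blast
  qed
  then show ?thesis by blast
qed simp

lemma isolated_common_point_all:
  fixes B :: "'a::{ab_group_add, finite} set"
  assumes one: "\<And>x. x \<in> S \<Longrightarrow> card (exits B x) = 1"
    and xy: "x \<in> S" "y \<in> S" "x \<noteq> y" "x \<noteq> - y"
  shows "(\<exists>a. \<forall>z\<in>S. isolated B a z) \<or> (\<exists>b. \<forall>z\<in>S. isolated (- B) b z)"
proof -
  have pair: "(\<exists>a. isolated B a u \<and> isolated B a v) \<or> (\<exists>b. isolated (- B) b u \<and> isolated (- B) b v)"
    if "u \<in> S" "v \<in> S" "u \<noteq> v" "u \<noteq> - v" for u v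
    using that one by (intro isolated_common_point) auto
  have pair': "(\<exists>b. isolated (- B) b u \<and> isolated (- B) b v) \<or> (\<exists>a. isolated B a u \<and> isolated B a v)"
    if "u \<in> S" "v \<in> S" "u \<noteq> v" "u \<noteq> - v" for u v
    using pair[OF that] by blast
  from pair[OF xy] show ?thesis
  proof
    assume "\<exists>a. isolated B a x \<and> isolated B a y"
    then obtain a where a: "isolated B a x" "isolated B a y" by blast
    have "(\<forall>z\<in>S. isolated B a z) \<or> (\<exists>b. \<forall>z\<in>S. isolated (- B) b z)"
      by (rule common_point_extends[of x S y "isolated B" a "isolated (- B)"])
        (use xy a pair in \<open>auto simp: isolated_uminus dest: isolated_unique\<close>)
    then show ?thesis by blast
  next
    assume "\<exists>b. isolated (- B) b x \<and> isolated (- B) b y"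
    then obtain b where b: "isolated (- B) b x" "isolated (- B) b y" by blast
    have "(\<forall>z\<in>S. isolated (- B) b z) \<or> (\<exists>a. \<forall>z\<in>S. isolated B a z)"
      by (rule common_point_extends[of x S y "isolated (- B)" b "isolated B"])
        (use xy b pair' in \<open>auto simp: isolated_uminus dest: isolated_unique\<close>)
    then show ?thesis by blast
  qed
qed

text \<open>Either some direction has no exit, and then the exits in any other direction \<open>v\<close> would come in
  pairs \<open>t\<close>, \<open>t + u\<close>, so \<open>B\<close> is invariant under the subgroup; or \<open>B\<close> is invariant up to one
  common extra or missing point. The bound \<open>2 \<le> card B\<close> rules out that \<open>B\<close> consists of
  the extra point alone.\<close>

lemma card_closure_le_if_few_exits:
  fixes B :: "'a::{ab_group_add, finite} set"
  assumes few: "\<And>x. x \<in> S \<Longrightarrow> card (exits B x) \<le> 1"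
    and "0 \<notin> S" and xy: "x \<in> S" "y \<in> S" "x \<noteq> y" "x \<noteq> - y"
    and "card B \<ge> 2"
  shows "card (group_closure S) \<le> card B + 1"
proof (cases "\<exists>x\<in>S. exits B x = {}")
  case True
  then obtain u where u: "u \<in> S" "exits B u = {}" by blast
  have "u \<noteq> 0" using u \<open>0 \<notin> S\<close> by auto
  have "t + v \<in> B" if "v \<in> S" "t \<in> B" for t v
  proof (rule ccontr)
    assume "t + v \<notin> B"
    moreover have "t + u \<in> B" using u that by (auto simp: exits_def)
    moreover have "t + u + v \<notin> B"
    proof
      assume "t + u + v \<in> B"
      then have "(t + u + v) - u \<in> B"
        using u diff_mem_if_translation_closed[of B u "t + u + v"] by (auto simp: exits_def)
      then show False using \<open>t + v \<notin> B\<close> by (simp add: algebra_simps)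
    qed
    ultimately have "t = t + u" using exit_unique[of B v] few that by blast
    then show False using \<open>u \<noteq> 0\<close> by simp
  qed
  moreover have "B \<noteq> {}" using \<open>card B \<ge> 2\<close> by auto
  ultimately show ?thesis using card_closure_le_if_closed[of S B] by fastforce
next
  case False
  have one: "card (exits B x) = 1" if "x \<in> S" for x
  proof -
    have "card (exits B x) \<noteq> 0" using False that by auto
    then show ?thesis using few[OF that] by linarith
  qed
  from isolated_common_point_all[OF one xy] consider a where "\<forall>z\<in>S. isolated B a z" | b where "\<forall>z\<in>S. isolated (- B) b z"
    by blast
  then show ?thesis
  proof cases
    case 1
    have "t + z \<in> B - {a}" if "z \<in> S" "t \<in> B - {a}" for t z
    proof -
      have iso: "isolated B a z" using 1 that by simp
      then have "t + z \<in> B" using that by (auto simp: isolated_def)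
      moreover have "a - z \<notin> B" using iso by (auto simp: isolated_def)
      then have "t + z \<noteq> a" using that by (auto simp: algebra_simps)
      ultimately show ?thesis by simp
    qed
    moreover have "B - {a} \<noteq> {}"
    proof
      assume "B - {a} = {}"
      then have "card B \<le> card {a}" by (intro card_mono) auto
      then show False using \<open>card B \<ge> 2\<close> by simp
    qed
    ultimately have "card (group_closure S) \<le> card (B - {a})"
      by (rule card_closure_le_if_closed)
    also have "\<dots> \<le> card B" by (rule card_mono) auto
    finally show ?thesis by simp
  next
    case 2
    have "t + z \<in> insert b B" if "z \<in> S" "t \<in> insert b B" for t z
    proof (rule ccontr)
      assume out: "t + z \<notin> insert b B"
      have iso: "isolated (- B) b z" using 2 that by simp
      then have "(t + z) - z \<in> - B" using out unfolding isolated_def by blast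
      then have "t = b" using that by simp
      then show False using iso out by (auto simp: isolated_def)
    qed
    then have "card (group_closure S) \<le> card (insert b B)"
      by (intro card_closure_le_if_closed) auto
    also have "\<dots> \<le> card B + 1" by (simp add: card_insert_if)
    finally show ?thesis .
  qed
qed

section \<open>Sums of pairs and triples\<close>

lemma card_subset_sums_insert:
  fixes A :: "'a::{ab_group_add, finite} set"
  assumes "x \<notin> A"
  shows "card (subset_sums (insert x A)) = card (subset_sums A) + card (exits (subset_sums A) x)"
proof -
  let ?C = "subset_sums A"
  have "subset_sums (insert x A) = ?C \<union> (+) x ` exits ?C x"
    using subset_sums_insert[OF assms] by (auto simp: exits_def add.commute)
  moreover have "?C \<inter> (+) x ` exits ?C x = {}" by (auto simp: exits_def add.commute)
  ultimately show ?thesis by (simp add: card_Un_disjoint card_image)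
qed

lemma subset_sums_singleton: "subset_sums {a} = {0, a :: 'a::{ab_group_add, finite}}"
  using subset_sums_insert[of a "{}"] by auto

lemma subset_sums_pair: "a \<noteq> b \<Longrightarrow> subset_sums {a, b} = {0, a, b, a + b :: 'a::{ab_group_add, finite}}"
  using subset_sums_insert[of a "{b}"] by (auto simp: subset_sums_singleton)

lemma card_subset_sums_pair:
  fixes a b :: "'a::{ab_group_add, finite}"
  assumes "a \<noteq> 0" "b \<noteq> 0" "a \<noteq> b" "a \<noteq> - b"
  shows "card (subset_sums {a, b}) = 4"
  using assms by (auto simp: subset_sums_pair eq_neg_iff_add_eq_0)

text \<open>Up to signs, the degenerate triples are the multisets \<open>{x, x, y}\<close> and \<open>{e, x, x + e}\<close> with an involution \<open>e\<close>. These
  are the triples whose elements satisfy two different relations of the form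
  \<open>a + b = c\<close>, \<open>a + c = b\<close>, \<open>b + c = a\<close>, \<open>a + b + c = 0\<close>, together with those containing a pair \<open>x\<close>, \<open>- x\<close>.\<close>

definition degenerate :: "'a::ab_group_add \<Rightarrow> 'a \<Rightarrow> 'a \<Rightarrow> bool" where
  "degenerate a b c \<longleftrightarrow> a = - b \<or> a = - c \<or> b = - c \<or>
     (a = - a \<and> (b = c + a \<or> b = - c + a)) \<or>
     (b = - b \<and> (a = c + b \<or> a = - c + b)) \<or>
     (c = - c \<and> (a = b + c \<or> a = - b + c))"

lemma nondegenerate_relations:
  fixes a b c :: "'a::ab_group_add"
  assumes "\<not> degenerate a b c"
  shows "\<not> (c = a + b \<and> b = a + c)" "\<not> (c = a + b \<and> a = b + c)" "\<not> (c = a + b \<and> a + b + c = 0)"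
    "\<not> (b = a + c \<and> a = b + c)" "\<not> (b = a + c \<and> a + b + c = 0)" "\<not> (a = b + c \<and> a + b + c = 0)"
  using assms unfolding degenerate_def
  by (metis add.commute add.left_commute add_cancel_right_right eq_neg_iff_add_eq_0 add.assoc minus_add_cancel)+

text \<open>A sum of \<open>{a, b}\<close> that stays among these sums after adding \<open>c\<close> records a linear relation between
  \<open>a\<close>, \<open>b\<close> and \<open>c\<close>; each relation accounts for one of the four sums.\<close>

lemma exits_pair_sums:
  fixes a b c :: "'a::{ab_group_add, finite}"
  assumes "a \<noteq> 0" "b \<noteq> 0" "c \<noteq> 0" "a \<noteq> b" "a \<noteq> c" "b \<noteq> c" "a \<noteq> - b" "a \<noteq> - c" "b \<noteq> - c"
    and "t \<in> subset_sums {a, b}" "t \<notin> exits (subset_sums {a, b}) c"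
  shows "t = 0 \<and> c = a + b \<or> t = a \<and> b = a + c \<or> t = b \<and> a = b + c \<or> t = a + b \<and> a + b + c = 0"
proof -
  have "a + b \<noteq> 0" "a + c \<noteq> 0" "b + c \<noteq> 0"
    using assms by (auto simp: eq_neg_iff_add_eq_0)
  with assms show ?thesis by (auto simp: exits_def subset_sums_pair add.assoc add.commute)
qed

text \<open>Of the four possible relations at most one holds, so at most one of the eight sums is
  repeated.\<close>

lemma card_subset_sums_nondegenerate_triple:
  fixes a b c :: "'a::{ab_group_add, finite}"
  assumes nz: "a \<noteq> 0" "b \<noteq> 0" "c \<noteq> 0" and ne: "a \<noteq> b" "a \<noteq> c" "b \<noteq> c"
    and nd: "\<not> degenerate a b c"
  shows "7 \<le> card (subset_sums {a, b, c})"
proof -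
  let ?A = "subset_sums {a, b}"
  have asym: "a \<noteq> - b" "a \<noteq> - c" "b \<noteq> - c" using nd by (auto simp: degenerate_def)
  have A4: "card ?A = 4" using nz ne asym by (intro card_subset_sums_pair)
  have "s = t" if "s \<in> ?A - exits ?A c" "t \<in> ?A - exits ?A c" for s t
    using exits_pair_sums[OF nz ne asym, of s] exits_pair_sums[OF nz ne asym, of t]
      that nondegenerate_relations[OF nd] by blast
  then have "card (?A - exits ?A c) \<le> 1"
    by (auto simp: card_le_Suc0_iff_eq)
  moreover have "card (?A - exits ?A c) = card ?A - card (exits ?A c)"
    by (rule card_Diff_subset) (auto simp: exits_def)
  ultimately have "3 \<le> card (exits ?A c)" using A4 by simp
  then show ?thesis
    using card_subset_sums_insert[of c "{a, b}"] A4 ne by (simp add: insert_commute)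
qed

text \<open>Here two relations may hold. Neither of the pairs \<open>b + c = a\<close>, \<open>a + b + c = 0\<close> and
  \<open>b + a = c\<close>, \<open>c + a = b\<close> can hold together, since both would give \<open>a + a = 0\<close>.\<close>

lemma card_subset_sums_asymmetric_triple:
  fixes a b c :: "'a::{ab_group_add, finite}"
  assumes nz: "a \<noteq> 0" "b \<noteq> 0" "c \<noteq> 0" and ne: "a \<noteq> b" "a \<noteq> c" "b \<noteq> c"
    and asym: "a \<noteq> - b" "a \<noteq> - c" "b \<noteq> - c" and "a \<noteq> - a"
  shows "6 \<le> card (subset_sums {a, b, c})"
proof -
  let ?A = "subset_sums {b, c}"
  let ?E = "exits ?A a"
  have A4: "card ?A = 4" using nz ne asym by (intro card_subset_sums_pair) auto
  have rel: "t = 0 \<and> a = b + c \<or> t = b \<and> c = b + a \<or> t = c \<and> b = c + a \<or> t = b + c \<and> b + c + a = 0"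
    if "t \<in> ?A" "t \<notin> ?E" for t
  proof -
    have "b \<noteq> - a" "c \<noteq> - a" using asym by auto
    then show ?thesis
      using exits_pair_sums[of b c a t] that nz ne asym by blast
  qed
  have aa: "a + a \<noteq> 0" using \<open>a \<noteq> - a\<close> by (simp add: eq_neg_iff_add_eq_0)
  have mem: "b \<in> ?A" "c \<in> ?A" "b + c \<in> ?A" using ne by (auto simp: subset_sums_pair)
  have bc: "b + c \<noteq> 0" using asym by (auto simp: eq_neg_iff_add_eq_0)
  have 1: "0 \<in> ?E \<or> b + c \<in> ?E"
  proof (rule ccontr)
    assume "\<not> ?thesis"
    then have "a = b + c" "b + c + a = 0"
      using rel[of 0] rel[of "b + c"] mem bc nz by auto
    then show False using aa by simp
  qed
  have 2: "b \<in> ?E \<or> c \<in> ?E"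
  proof (rule ccontr)
    assume "\<not> ?thesis"
    then have "c = b + a" "b = c + a"
      using rel[of b] rel[of c] mem ne nz by auto
    then have "b = b + (a + a)" by (metis add.assoc)
    then show False using aa by simp
  qed
  have "\<exists>s\<in>?E. \<exists>t\<in>?E. s \<noteq> t" using 1 2 nz by (metis add_cancel_right_left add_cancel_right_right)
  then have "\<not> card ?E \<le> Suc 0" by (auto simp: card_le_Suc0_iff_eq)
  then show ?thesis
    using card_subset_sums_insert[of a "{b, c}"] A4 ne by simp
qed

lemma card_subset_sums_symmetric_triple:
  fixes a v :: "'a::{ab_group_add, finite}"
  assumes "a \<noteq> 0" "v \<noteq> 0" "a \<noteq> - a" "v \<noteq> a" "v \<noteq> - a" "v \<noteq> a + a" "v \<noteq> - a - a"
  shows "6 \<le> card (subset_sums {a, - a, v})"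
proof -
  let ?A = "subset_sums {a, - a}"
  have A: "?A = {0, a, - a}" using assms by (auto simp: subset_sums_pair)
  then have A3: "card ?A = 3" using assms by simp
  have "a + v \<noteq> - a" using assms by (metis add_diff_cancel_left')
  moreover have "- a + v \<noteq> a" using assms by (metis add_minus_cancel)
  moreover have "a + v \<noteq> 0" using assms by (simp add: add_eq_0_iff)
  ultimately have "exits ?A v = ?A"
    using assms by (auto simp: exits_def A)
  then show ?thesis
    using card_subset_sums_insert[of v "{a, - a}"] A3 assms by (simp add: insert_commute)
qed

lemma degenerate_involutionD:
  fixes a p q :: "'a::ab_group_add"
  assumes deg: "degenerate a p q" and "a = - a" "a \<noteq> p" "a \<noteq> q" "p \<noteq> - q"
  shows "q = p + a \<or> q = - p + a"
proof -
  have aa: "t + a + a = t" for t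
    using \<open>a = - a\<close> by (simp add: add.assoc eq_neg_iff_add_eq_0)
  have "a \<noteq> - p" "a \<noteq> - q" using \<open>a = - a\<close> \<open>a \<noteq> p\<close> \<open>a \<noteq> q\<close> by (metis minus_minus)+
  then consider "p = q + a \<or> p = - q + a" | "a = q + p \<or> a = - q + p" | "a = p + q \<or> a = - p + q"
    using deg \<open>p \<noteq> - q\<close> unfolding degenerate_def by blast
  then show ?thesis
  proof cases
    case 1
    then have "p + a = q \<or> p + a = - q" using aa by auto
    then show ?thesis using \<open>a = - a\<close> by (metis minus_add_distrib minus_minus)
  next
    case 2
    then have "q = - p + a \<or> q = p + - a" by auto
    then show ?thesis using \<open>a = - a\<close> by metis
  next
    case 3
    then have "q = - p + a \<or> q = p + a" by auto
    then show ?thesis by blast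
  qed
qed

text \<open>Without pairs of opposite elements, degeneracy at an involution \<open>a\<close> leaves only \<open>b + a\<close>
  and \<open>- b + a\<close> for the third element; hence \<open>c\<close> and \<open>d\<close> would be the two opposite values.\<close>

lemma no_two_degenerate_triples_at_involution:
  fixes a b c d :: "'a::ab_group_add"
  assumes ne: "a \<noteq> b" "a \<noteq> c" "a \<noteq> d" "b \<noteq> c" "b \<noteq> d" "c \<noteq> d"
    and "a = - a"
    and "b \<noteq> - c" "b \<noteq> - d" "c \<noteq> - d"
    and "degenerate a b c" "degenerate a b d"
  shows False
proof -
  have "c = b + a \<or> c = - b + a" "d = b + a \<or> d = - b + a"
    using degenerate_involutionD[of a b c] degenerate_involutionD[of a b d] assms by auto
  then have "c + d = (b + a) + (- b + a)" using ne by (auto simp: add.commute)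
  also have "\<dots> = a + a" by simp
  also have "\<dots> = 0" using \<open>a = - a\<close> by (simp add: eq_neg_iff_add_eq_0)
  finally show False using \<open>c \<noteq> - d\<close> by (simp add: eq_neg_iff_add_eq_0)
qed

lemma degenerate_involution:
  "degenerate a b c \<Longrightarrow> a \<noteq> - b \<Longrightarrow> a \<noteq> - c \<Longrightarrow> b \<noteq> - c \<Longrightarrow> a = - a \<or> b = - b \<or> c = - c"
  by (auto simp: degenerate_def)

section \<open>Sums of quadruples\<close>

lemma sum_in_subset_sums: "B \<subseteq> A \<Longrightarrow> \<Sum>B \<in> subset_sums A"
  by (auto simp: subset_sums_def)

text \<open>The triple gives seven sums. If the fourth element \<open>d\<close> adds none, the sums are invariant
  under \<open>d\<close>; as seven is prime, they are the cyclic group generated by \<open>d\<close>.\<close>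

lemma card_subset_sums_quadruple_if_nondegenerate_triple:
  fixes V :: "'a::{ab_group_add, finite} set"
  assumes "card V = 4" "0 \<notin> V" and xyz: "x \<in> V" "y \<in> V" "z \<in> V" "x \<noteq> y" "x \<noteq> z" "y \<noteq> z"
    and "\<not> degenerate x y z"
  shows "8 \<le> card (subset_sums V) \<or> subset_sums V = group_closure V"
proof (rule ccontr)
  assume no: "\<not> ?thesis"
  let ?U = "{x, y, z}"
  have "card (V - ?U) = 1" using assms by (simp add: card_Diff_subset)
  then obtain d where d: "V - ?U = {d}" by (auto simp: card_1_singleton_iff)
  then have V: "V = insert d ?U" and "d \<notin> ?U" and "d \<noteq> 0" using xyz \<open>0 \<notin> V\<close> by auto
  have "7 \<le> card (subset_sums ?U)"
    using assms by (intro card_subset_sums_nondegenerate_triple) auto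
  moreover have eq: "card (subset_sums V) = card (subset_sums ?U) + card (exits (subset_sums ?U) d)"
    unfolding V by (rule card_subset_sums_insert) fact
  ultimately have c7: "card (subset_sums V) = 7" and "card (exits (subset_sums ?U) d) = 0"
    using no by linarith+
  then have "exits (subset_sums ?U) d = {}" by simp
  moreover have "subset_sums ?U = subset_sums V"
  proof (rule card_seteq)
    show "subset_sums ?U \<subseteq> subset_sums V" using V by (intro subset_sums_mono) blast
  qed (use c7 eq \<open>card (exits (subset_sums ?U) d) = 0\<close> in simp_all)
  ultimately have per: "t + d \<in> subset_sums V" if "t \<in> subset_sums V" for t
    using that by (auto simp: exits_def)
  let ?K = "group_closure {d}"
  have "card ?K dvd 7"
    using card_closure_dvd_if_closed[of "{d}" "subset_sums V"] per c7 by auto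
  moreover have "card ?K \<noteq> 1"
  proof
    assume "card ?K = 1"
    then obtain k where "?K = {k}" by (auto simp: card_1_singleton_iff)
    then show False using zero_in_group_closure[of "{d}"] subset_closure[of "{d}"] \<open>d \<noteq> 0\<close> by auto
  qed
  moreover have "n = 1 \<or> n = 7" if "n dvd 7" for n :: nat
  proof -
    have "n \<le> 7" using that by (auto dest: dvd_imp_le)
    then have "n \<in> {0, 1, 2, 3, 4, 5, 6, 7}" by auto
    then show ?thesis using that by auto
  qed
  ultimately have "card ?K = 7" by blast
  moreover have "?K \<subseteq> subset_sums V"
    using closed_contains_closure[of "{d}" "subset_sums V"] per by auto
  ultimately have K: "?K = subset_sums V" using c7 by (intro card_seteq) auto
  have "V \<subseteq> ?K" unfolding K by (auto intro: elem_in_subset_sums)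
  then have "group_closure V \<subseteq> ?K" by (rule group_closure_least)
  then show False using no K subset_sums_subset_closure[of V] by auto
qed

text \<open>Modulo \<open>e\<close> the sums are \<open>- x, 0, x, 2x\<close>, each lifted twice. Two of them coincide only if \<open>x\<close>
  has order three modulo \<open>e\<close>, and then they exhaust the subgroup.\<close>

lemma card_subset_sums_involution_quadruple:
  fixes e x :: "'a::{ab_group_add, finite}"
  assumes ee: "e = - e" and nz: "e \<noteq> 0" "x \<noteq> 0" "x \<noteq> e" and inv: "x \<noteq> - x" "x + e \<noteq> - x"
  shows "8 \<le> card (subset_sums {e, x, - x, x + e}) \<or>
    subset_sums {e, x, - x, x + e} = group_closure {e, x, - x, x + e}"
proof -
  let ?V = "{e, x, - x, x + e}"
  have ee0: "e + e = 0" using ee by (simp add: eq_neg_iff_add_eq_0)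
  have ee0': "e + (e + t) = t" "- e = e" for t using ee0 ee by (simp_all flip: add.assoc)
  have ne: "x + e \<noteq> 0" "x + e \<noteq> e" "x + e \<noteq> x" "- x \<noteq> e"
    using nz ee by (auto simp: add_eq_0_iff2)
  have "{0, e, x, x + e, - x, - x + e, x + x + e} \<subseteq> subset_sums ?V"
    using sum_in_subset_sums[of "{e}" ?V] sum_in_subset_sums[of "{x}" ?V]
      sum_in_subset_sums[of "{x + e}" ?V] sum_in_subset_sums[of "{- x}" ?V]
      sum_in_subset_sums[of "{e, - x}" ?V] sum_in_subset_sums[of "{x, x + e}" ?V] ne
    by (simp add: add_ac)
  moreover have "x + x \<in> subset_sums ?V"
    using sum_in_subset_sums[of "{e, x, x + e}" ?V] ne nz by (simp add: add_ac ee0')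
  ultimately have sub: "{0, e, x, x + e, - x, - x + e, x + x, x + x + e} \<subseteq> subset_sums ?V"
    by simp
  show ?thesis
  proof (cases "x + x = - x \<or> x + x = - x + e")
    case True
    let ?X = "{0, e, x, x + e, - x, - x + e}"
    have xx: "x + (x + t) = - x + t \<or> x + (x + t) = - x + (e + t)" for t
    proof -
      have "x + (x + t) = (x + x) + t" by (simp add: add.assoc)
      also have "\<dots> = - x + t \<or> \<dots> = - x + (e + t)" using True by (auto simp: add.assoc)
      finally show ?thesis .
    qed
    have "t + e \<in> ?X" if "t \<in> ?X" for t
      using that ee0 by (elim insertE) (simp_all add: add.assoc)
    moreover have "t + x \<in> ?X" if "t \<in> ?X" for t
      using that True xx[of e] ee0 by (elim insertE disjE) (simp_all add: add_ac)
    ultimately have "u \<in> {e, x} \<Longrightarrow> t \<in> ?X \<Longrightarrow> t + u \<in> ?X" for t u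
      by blast
    then have "group_closure {e, x} \<subseteq> ?X"
      by (rule closed_contains_closure) (assumption | rule insertI1)+
    moreover have "group_closure ?V \<subseteq> group_closure {e, x}"
    proof (rule group_closure_least)
      have "e \<in> group_closure {e, x}" "x \<in> group_closure {e, x}"
        using subset_closure by blast+
      then show "?V \<subseteq> group_closure {e, x}"
        using group_closure_add[of x "{e, x}" e] by simp
    qed
    ultimately show ?thesis using sub subset_sums_subset_closure[of ?V] by auto
  next
    case False
    have "x + x \<noteq> 0" "x \<noteq> - x + e" "x + x \<noteq> e" "x + x + e \<noteq> 0" "x + x + e \<noteq> - x"
    proof -
      have *: "u + e = v \<longleftrightarrow> u = v + e" for u v :: 'a
      proof -
        have "u + e + e = u" "v + e + e = v" using ee0 by (simp_all add: add.assoc)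
        then show ?thesis by auto
      qed
      show "x + x \<noteq> 0" using inv by (simp add: eq_neg_iff_add_eq_0)
      show "x \<noteq> - x + e" using inv *[of x "- x"] by simp
      show "x + x \<noteq> e" using inv *[of x "- x"] by (auto simp: algebra_simps)
      then show "x + x + e \<noteq> 0" using *[of "x + x" 0] by simp
      show "x + x + e \<noteq> - x" using False *[of "x + x" "- x"] by simp
    qed
    then have "card {0, e, x, x + e, - x, - x + e, x + x, x + x + e} = 8"
      using nz inv ne False by auto
    then show ?thesis using card_mono[OF finite sub] by simp
  qed
qed

text \<open>A degenerate triple without opposite elements contains an involution, and an involution
  cannot lie in two degenerate triples that share a further element.\<close>

lemma nondegenerate_triple_if_asymmetric:
  fixes V :: "'a::{ab_group_add, finite} set"
  assumes "card V = 4" and asym: "\<And>x y. x \<in> V \<Longrightarrow> y \<in> V \<Longrightarrow> x \<noteq> y \<Longrightarrow> x \<noteq> - y"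
  shows "\<exists>x\<in>V. \<exists>y\<in>V. \<exists>z\<in>V. x \<noteq> y \<and> x \<noteq> z \<and> y \<noteq> z \<and> \<not> degenerate x y z"
proof (rule ccontr)
  assume "\<not> ?thesis"
  then have deg: "degenerate x y z" if "x \<in> V" "y \<in> V" "z \<in> V" "x \<noteq> y" "x \<noteq> z" "y \<noteq> z" for x y z
    using that by blast
  obtain U where U: "U \<subseteq> V" "card U = 3"
    using obtain_subset_with_card_n[of 3 V] assms by auto
  then obtain x y z where xyz: "U = {x, y, z}" "x \<noteq> y" "x \<noteq> z" "y \<noteq> z"
    by (auto simp: card_3_iff)
  have "x = - x \<or> y = - y \<or> z = - z"
    using degenerate_involution[of x y z] deg asym xyz U by auto
  then obtain a where a: "a \<in> V" "a = - a" using U xyz by auto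
  have "card (V - {a}) = 3" using a assms by simp
  then obtain b c d where bcd: "V - {a} = {b, c, d}" "b \<noteq> c" "b \<noteq> d" "c \<noteq> d"
    by (auto simp: card_3_iff)
  then have mem: "b \<in> V" "c \<in> V" "d \<in> V" "a \<noteq> b" "a \<noteq> c" "a \<noteq> d" by auto
  then show False
    using no_two_degenerate_triples_at_involution[of a b c d] a bcd(2-) asym deg by auto
qed

text \<open>The exceptional form occurs: \<open>{\<plusminus> a, \<plusminus> 2a}\<close> has only the seven sums \<open>- 3a, \<dots>, 3a\<close>, also when \<open>a\<close>
  has large order.\<close>

lemma card_subset_sums_quadruple:
  fixes V :: "'a::{ab_group_add, finite} set"
  assumes "card V = 4" "0 \<notin> V"
  shows "8 \<le> card (subset_sums V) \<or> subset_sums V = group_closure V \<or>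
    (\<exists>a b. V = {a, - a, b, - b} \<and> a \<noteq> - a \<and> b \<noteq> - b \<and> a \<noteq> b \<and> a \<noteq> - b)"
proof (cases "\<exists>x\<in>V. \<exists>y\<in>V. \<exists>z\<in>V. x \<noteq> y \<and> x \<noteq> z \<and> y \<noteq> z \<and> \<not> degenerate x y z")
  case True
  then show ?thesis using card_subset_sums_quadruple_if_nondegenerate_triple[OF assms] by blast
next
  case False
  then have deg: "degenerate x y z" if "x \<in> V" "y \<in> V" "z \<in> V" "x \<noteq> y" "x \<noteq> z" "y \<noteq> z" for x y z
    using that by blast
  have "\<exists>a\<in>V. - a \<in> V \<and> a \<noteq> - a"
  proof (rule ccontr)
    assume "\<not> ?thesis"
    then have asym: "x \<noteq> - y" if "x \<in> V" "y \<in> V" "x \<noteq> y" for x y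
      using that by (metis minus_minus)
    then show False using nondegenerate_triple_if_asymmetric[of V] deg assms(1) by blast
  qed
  then obtain a where a: "a \<in> V" "- a \<in> V" "a \<noteq> - a" by blast
  have "card (V - {a, - a}) = 2" using a assms by (simp add: card_Diff_subset)
  then obtain c d where cd: "V - {a, - a} = {c, d}" "c \<noteq> d" by (auto simp: card_2_iff)
  then have V: "V = {a, - a, c, d}" using a by auto
  have mem: "a \<noteq> c" "a \<noteq> d" "- a \<noteq> c" "- a \<noteq> d" using cd by auto
  show ?thesis
  proof (cases "c = - d")
    case True
    then have "V = {a, - a, d, - d} \<and> a \<noteq> - a \<and> d \<noteq> - d \<and> a \<noteq> d \<and> a \<noteq> - d"
      using V a mem cd by auto
    then show ?thesis by blast
  next
    case False
    have nz: "a \<noteq> 0" "c \<noteq> 0" "d \<noteq> 0" using V assms by auto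
    have shift: "d' = a + e \<or> d' = - a + e" if "e = - e" "a = d' + e \<or> a = - d' + e" for d' e
    proof -
      have "e + e = 0" using \<open>e = - e\<close> by (simp add: eq_neg_iff_add_eq_0)
      then show ?thesis using that(2) by (auto simp: add.assoc)
    qed
    have fin: ?thesis if "e = - e" "V = {e, x, - x, x + e}" "x \<noteq> - x" for e x
    proof -
      have "x + e \<noteq> - x"
      proof
        assume "x + e = - x"
        then have "V = {e, x, - x}" using that by auto
        then have "card V \<le> 3" using card_insert_le_m1[of 3 "{x, - x}" e]
          by (simp add: card_insert_if split: if_splits)
        then show False using assms by simp
      qed
      moreover have "e \<noteq> 0" "x \<noteq> 0" "x \<noteq> e" using that assms by auto
      ultimately show ?thesis
        using card_subset_sums_involution_quadruple[of e x] that(1,3) unfolding that(2)[symmetric]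
        by blast
    qed
    have "degenerate a c d" using deg[of a c d] V mem cd by auto
    moreover have "a \<noteq> - c" "a \<noteq> - d" using mem by auto
    ultimately consider "c = - c" "a = d + c \<or> a = - d + c" | "d = - d" "a = c + d \<or> a = - c + d"
      using False a(3) unfolding degenerate_def by blast
    then consider e where "e = - e" "V = {e, a, - a, a + e}" | e where "e = - e" "V = {e, - a, a, - a + e}"
    proof cases
      case 1
      then show ?thesis using shift[of c d] V that by (metis insert_commute)
    next
      case 2
      then show ?thesis using shift[of d c] V that by (metis insert_commute)
    qed
    then show ?thesis using fin[of _ a] fin[of _ "- a"] a(3) by cases auto
  qed
qed

section \<open>Splitting off a nondegenerate triple\<close>

lemma degenerate_rotate:
  fixes a b c :: "'a::ab_group_add"
  shows "degenerate a b c \<longleftrightarrow> degenerate c a b"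
proof -
  have "x = - y \<longleftrightarrow> y = - x" for x y :: 'a by auto
  moreover have "x = - y + z \<longleftrightarrow> y = - x + z" for x y z :: 'a
    by (auto simp: algebra_simps)
  moreover have "x = y + z \<longleftrightarrow> y = x + z" if "z = - z" for x y z :: 'a
  proof -
    have "z + z = 0" using that by (simp add: eq_neg_iff_add_eq_0)
    then have "w + z + z = w" for w by (simp add: add.assoc)
    then show ?thesis by metis
  qed
  ultimately show ?thesis unfolding degenerate_def by blast
qed

text \<open>The first form is \<open>{\<plusminus> a, 2a}\<close> with sums \<open>- a, \<dots>, 3a\<close>; the second is a Klein four-group
  without zero.\<close>

lemma triple_with_few_sums:
  fixes V :: "'a::{ab_group_add, finite} set"
  assumes "card V = 3" "0 \<notin> V" "card (subset_sums V) < 6"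
  shows "(\<exists>a. V = {a, - a, a + a} \<and> a \<noteq> - a) \<or> (\<exists>e f. V = {e, f, e + f} \<and> (\<forall>v\<in>V. v = - v))"
proof (cases "\<exists>a\<in>V. - a \<in> V \<and> a \<noteq> - a")
  case True
  then obtain a where a: "a \<in> V" "- a \<in> V" "a \<noteq> - a" by blast
  have "card (V - {a, - a}) = 1" using a assms by (simp add: card_Diff_subset)
  then obtain v where v: "V - {a, - a} = {v}" by (auto simp: card_1_singleton_iff)
  then have V: "V = {a, - a, v}" and "v \<noteq> a" "v \<noteq> - a" using a by auto
  then have "v = a + a \<or> v = - a - a"
    using card_subset_sums_symmetric_triple[of a v] a assms by force
  then have "V = {a, - a, a + a} \<or> V = {- a, - (- a), - a + - a}" using V by auto
  moreover have "- a \<noteq> - (- a)" using a by simp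
  ultimately show ?thesis using a by blast
next
  case False
  then have asym: "x \<noteq> - y" if "x \<in> V" "y \<in> V" "x \<noteq> y" for x y
    using that by (metis minus_minus)
  have inv: "v = - v" if "v \<in> V" for v
  proof (rule ccontr)
    assume "v \<noteq> - v"
    have "card (V - {v}) = 2" using that assms by simp
    then obtain x y where xy: "V - {v} = {x, y}" "x \<noteq> y" by (auto simp: card_2_iff)
    then have V: "V = {v, x, y}" "v \<noteq> x" "v \<noteq> y" using that by auto
    then show False
      using card_subset_sums_asymmetric_triple[of v x y] \<open>v \<noteq> - v\<close> xy asym assms by auto
  qed
  obtain x y z where xyz: "V = {x, y, z}" "x \<noteq> y" "x \<noteq> z" "y \<noteq> z"
    using assms by (auto simp: card_3_iff)
  then have "degenerate x y z"
    using card_subset_sums_nondegenerate_triple[of x y z] assms by fastforce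
  then have "z = y + x \<or> z = - y + x"
    using degenerate_involutionD[of x y z] inv asym xyz by auto
  then have "z = y + x" using inv[of y] xyz by auto
  then have "V = {y, x, y + x}" using xyz by auto
  then show ?thesis using inv by blast
qed

text \<open>If two of the elements were involutions, the degeneracy relation would make the third one
  their sum, hence an involution too.\<close>

lemma degenerate_exactly_one_involution:
  fixes a p q :: "'a::ab_group_add"
  assumes "degenerate p q a" "a \<noteq> - a" "p \<noteq> - q" "p \<noteq> - a" "q \<noteq> - a" "p \<noteq> q" "p \<noteq> a"
  shows "(p = - p) \<noteq> (q = - q)"
proof -
  have "p = - p \<or> q = - q" using degenerate_involution[of p q a] assms by blast
  moreover have False if "p = - p" "q = - q"
  proof -
    have "a = q + p \<or> a = - q + p" using degenerate_involutionD[of p q a] that assms by blast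
    then have "a = q + p" using that by auto
    then have "- a = a" using that by (metis minus_add_distrib)
    then show False using assms by simp
  qed
  ultimately show ?thesis by blast
qed

text \<open>If \<open>a\<close> formed a degenerate triple with each pair from \<open>x, y, z\<close>, every such pair would contain
  exactly one involution, which three elements cannot satisfy. So one of \<open>x, y, z\<close> can be
  exchanged for \<open>a\<close>; this separates \<open>a\<close> from \<open>- a\<close> when a set is split into two parts.\<close>

lemma nondegenerate_triple_exchange:
  fixes x y z a :: "'a::ab_group_add"
  assumes "\<not> degenerate x y z" "x \<noteq> y" "x \<noteq> z" "y \<noteq> z"
    and "a \<notin> {x, y, z}" "- a \<notin> {x, y, z}" "a \<noteq> - a"
  obtains p q r where "{p, q, r} = {x, y, z}" "p \<noteq> q" "p \<noteq> r" "q \<noteq> r" "\<not> degenerate p q a"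
proof -
  have asym: "x \<noteq> - y" "x \<noteq> - z" "y \<noteq> - z" using assms(1) by (auto simp: degenerate_def)
  have "\<not> degenerate x y a \<or> \<not> degenerate x z a \<or> \<not> degenerate y z a"
  proof (rule ccontr)
    assume "\<not> ?thesis"
    then have "(x = - x) \<noteq> (y = - y)" "(x = - x) \<noteq> (z = - z)" "(y = - y) \<noteq> (z = - z)"
      using degenerate_exactly_one_involution[of x y a] degenerate_exactly_one_involution[of x z a] degenerate_exactly_one_involution[of y z a] asym assms
      by auto
    then show False by blast
  qed
  then show ?thesis
    using that[of x y z] that[of x z y] that[of y z x] assms by (auto simp: insert_commute)
qed

text \<open>Two involutions \<open>e, f\<close> form a nondegenerate triple with any element except \<open>e + f\<close>. With at most
  one involution there are four further elements; three of them independent up to sign form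
  a nondegenerate triple, and otherwise they are \<open>\<plusminus> a, \<plusminus> b\<close> together with one involution
  \<open>e\<close>, and degeneracy of \<open>e, a, b\<close> gives \<open>b = \<plusminus> a + e\<close>. The exception is genuine: every triple of the displayed set is degenerate.\<close>

lemma nondegenerate_triple_exists:
  fixes S :: "'a::ab_group_add set"
  assumes "finite S" "card S \<ge> 5" "0 \<notin> S"
  shows "(\<exists>x\<in>S. \<exists>y\<in>S. \<exists>z\<in>S. x \<noteq> y \<and> x \<noteq> z \<and> y \<noteq> z \<and> \<not> degenerate x y z) \<or>
    (\<exists>e c. S = {e, c, - c, c + e, - c + e} \<and> e = - e \<and> c \<noteq> - c)"
proof (rule ccontr)
  assume no: "\<not> ?thesis"
  then have deg: "degenerate x y z" if "x \<in> S" "y \<in> S" "z \<in> S" "x \<noteq> y" "x \<noteq> z" "y \<noteq> z" for x y z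
    using that by blast
  have ex: "\<exists>c. c \<in> A - B" if "card B < card A" "finite B" for A B :: "'a set"
    using that by (metis card_mono subset_iff Diff_iff not_le)
  have one: "e = f" if ef: "e \<in> S" "f \<in> S" "e = - e" "f = - f" for e f
  proof (rule ccontr)
    assume "e \<noteq> f"
    have "card {e, f, e + f} < card S" using assms(2) by (auto simp: card_insert_if)
    then obtain c where c: "c \<in> S - {e, f, e + f}" using ex by blast
    have "f \<noteq> - c" using c ef by (auto simp: minus_equation_iff[of f])
    then have "c = f + e \<or> c = - f + e"
      using degenerate_involutionD[of e f c] deg[of e f c] ef c \<open>e \<noteq> f\<close> by auto
    then show False using c ef by (auto simp: add.commute)
  qed
  define N where "N = {s \<in> S. s \<noteq> - s}"
  have I1: "card (S - N) \<le> 1"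
    using one assms(1) by (auto simp: N_def card_le_Suc0_iff_eq)
  have "card N \<ge> 4"
    using card_Diff_subset[of N S] I1 assms by (simp add: N_def)
  have "card {} < card N" using \<open>card N \<ge> 4\<close> by simp
  then obtain a where a: "a \<in> N" using ex[of "{}" N] by auto
  have "card {a, - a} < card N" using \<open>card N \<ge> 4\<close> by (auto simp: card_insert_if)
  then obtain b where b: "b \<in> N" "b \<noteq> a" "b \<noteq> - a" using ex by blast
  have "N \<subseteq> {a, - a, b, - b}"
  proof
    fix c assume c: "c \<in> N"
    show "c \<in> {a, - a, b, - b}"
    proof (rule ccontr)
      assume "c \<notin> {a, - a, b, - b}"
      then have *: "a \<noteq> c" "b \<noteq> c" "a \<noteq> - c" "b \<noteq> - c" "a \<noteq> b" "a \<noteq> - b" using b by auto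
      then have "degenerate a b c" using a b c by (intro deg) (auto simp: N_def)
      then show False using degenerate_involution[of a b c] * a b c by (auto simp: N_def)
    qed
  qed
  moreover have le4: "card {a, - a, b, - b} \<le> 4" by (simp add: card_insert_if)
  ultimately have N: "N = {a, - a, b, - b}"
    using \<open>card N \<ge> 4\<close> by (intro card_seteq) auto
  then have "card N \<le> 4" using le4 by simp
  moreover have "card (S - N) = card S - card N"
    by (rule card_Diff_subset) (use assms(1) in \<open>auto simp: N_def\<close>)
  ultimately have "card (S - N) \<ge> 1" using assms(2) by simp
  then obtain e where e: "S - N = {e}" using I1 by (metis card_1_singletonE le_antisym)
  then have S: "S = {e, a, - a, b, - b}" and "e = - e" using N by (auto simp: N_def)
  have "e \<noteq> a" "e \<noteq> b" using e a b by auto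
  then have "degenerate e a b" using S b by (intro deg) auto
  then have "b = a + e \<or> b = - a + e"
  proof (rule degenerate_involutionD)
    show "a \<noteq> - b" using b by auto
  qed fact+
  moreover have "- (a + e) = - a + e" "- (- a + e) = a + e"
    using \<open>e = - e\<close> by (metis minus_add_distrib minus_minus)+
  ultimately have "S = {e, a, - a, a + e, - a + e}" using S by auto
  moreover have "a \<noteq> - a" using a by (simp add: N_def)
  ultimately show False using no \<open>e = - e\<close> by blast
qed

section \<open>Sets of at least half the size of their subgroup\<close>

lemma subset_sums_eq_closure_split:
  fixes S :: "'a::{ab_group_add, finite} set"
  assumes "U \<subseteq> S" "card (group_closure S) < card (subset_sums U) + card (subset_sums (S - U))"
  shows "subset_sums S = group_closure S"
proof (rule subset_sums_Un_eq_closure)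
  have S: "S = U \<union> (S - U)" using assms by auto
  show "subset_sums U \<subseteq> group_closure S" "subset_sums (S - U) \<subseteq> group_closure S"
    using subset_sums_subset_closure[of S] subset_sums_mono[of U S] subset_sums_mono[of "S - U" S] assms
    by auto
  show "u + v \<in> subset_sums S" if "u \<in> subset_sums U" "v \<in> subset_sums (S - U)" for u v
    using subset_sums_Un[of U "S - U" "u + v"] S that by auto
qed (fact assms)

text \<open>The sums contain the subgroup \<open>\<langle>V\<rangle>\<close>. Its index in \<open>\<langle>S\<rangle>\<close> is at most two, so one further
  element of \<open>S\<close> outside it reaches the only other coset.\<close>

lemma subset_sums_eq_closure_subgroup:
  fixes S :: "'a::{ab_group_add, finite} set"
  assumes "V \<subseteq> S" and V: "subset_sums V = group_closure V"
    and "card (group_closure S) < 3 * card (group_closure V)"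
  shows "subset_sums S = group_closure S"
proof (cases "S \<subseteq> group_closure V")
  case True
  then have "group_closure S \<subseteq> subset_sums V" unfolding V by (rule group_closure_least)
  also have "\<dots> \<subseteq> subset_sums S" using assms by (intro subset_sums_mono)
  finally show ?thesis using subset_sums_subset_closure by blast
next
  case False
  let ?K = "group_closure V" and ?H = "group_closure S"
  obtain u where u: "u \<in> S" "u \<notin> ?K" using False by auto
  then have "u \<notin> V" using subset_closure[of V] by auto
  have sub: "?K \<union> (+) u ` ?K \<subseteq> subset_sums S"
    using subset_sums_insert[OF \<open>u \<notin> V\<close>] subset_sums_mono[of "insert u V" S] u assms by auto
  have "?K \<inter> (+) u ` ?K = {}"
  proof (rule ccontr)
    assume "\<not> ?thesis"
    then obtain s t where "s \<in> ?K" "t \<in> ?K" "s = u + t" by blast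
    then have "s - t \<in> ?K" by (intro group_closure.diff)
    then show False using \<open>s = u + t\<close> u by simp
  qed
  then have "card (?K \<union> (+) u ` ?K) = 2 * card ?K"
    by (simp add: card_Un_disjoint card_image)
  then have le: "2 * card ?K \<le> card (subset_sums S)"
    using card_mono[OF finite sub] by simp
  have "card ?K dvd card ?H"
  proof (rule card_closure_dvd_if_closed)
    fix x t assume "x \<in> V" "t \<in> ?H"
    then show "t + x \<in> ?H" using assms(1) subset_closure[of S] by (auto intro: group_closure_add)
  qed
  then obtain k where k: "card ?H = card ?K * k" by (auto simp: dvd_def)
  have "?K \<noteq> {}" using zero_in_group_closure[of V] by blast
  then have "card ?K > 0" by (simp add: card_gt_0_iff)
  then have "k < 3" using assms(3) k by (simp add: mult.commute)
  then have "card ?H \<le> 2 * card ?K" using k by (simp add: mult.commute)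
  then show ?thesis
    using le subset_sums_subset_closure[of S] by (intro card_seteq) auto
qed

text \<open>No triple here is nondegenerate, so no split into a triple and a pair is large enough.
  But the involution may be used in both parts: the sums of \<open>{e, -c, -c + e}\<close> are invariant
  under \<open>e\<close>, so adding sums of \<open>{e, c, c + e}\<close> instead of \<open>{c, c + e}\<close> yields no new element.
  Each part has six sums, and \<open>6 + 6 > 10\<close>.\<close>

lemma subset_sums_involution_quintuple:
  fixes S :: "'a::{ab_group_add, finite} set"
  assumes S: "S = {e, c, - c, c + e, - c + e}" and "card S = 5" "0 \<notin> S"
    and e: "e = - e" and "c \<noteq> - c" and small: "card (group_closure S) \<le> 10"
  shows "subset_sums S = group_closure S"
proof -
  have ee: "e + e = 0" using e by (simp add: eq_neg_iff_add_eq_0)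
  have ne: "e \<noteq> c" "e \<noteq> - c" "c \<noteq> c + e" "- c \<noteq> - c + e" "e \<noteq> c + e" "e \<noteq> - c + e" "c \<noteq> - c + e" "c + e \<noteq> - c" "c + e \<noteq> - c + e"
    using assms(2) unfolding S by (auto simp: card_insert_if split: if_splits)
  let ?A = "subset_sums {e, c, c + e}" and ?C = "subset_sums {e, - c, - c + e}"
  have nz: "e \<noteq> 0" "c \<noteq> 0" "c + e \<noteq> 0" "- c + e \<noteq> 0" using assms(3) unfolding S by auto
  have me: "- (c + e) = - c + e" "- (- c + e) = c + e"
    using e by (metis minus_add_distrib minus_minus)+
  have "6 \<le> card (subset_sums {c, e, c + e})"
    by (rule card_subset_sums_asymmetric_triple) (use ne nz \<open>c \<noteq> - c\<close> me e in metis)+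
  then have A6: "6 \<le> card ?A" by (simp add: insert_commute)
  have "6 \<le> card (subset_sums {- c, e, - c + e})"
    by (rule card_subset_sums_asymmetric_triple) (use ne nz \<open>c \<noteq> - c\<close> me e in \<open>metis minus_minus neg_equal_0_iff_equal\<close>)+
  then have C6: "6 \<le> card ?C" by (simp add: insert_commute)
  have ecl: "u + e \<in> subset_sums (insert e B)" if "u \<in> subset_sums (insert e B)" "e \<notin> B" for u and B :: "'a set"
  proof -
    have "u \<in> subset_sums B \<union> (+) e ` subset_sums B"
      using that(1) unfolding subset_sums_insert[OF that(2)] .
    then obtain t where t: "t \<in> subset_sums B" "u = t \<or> u = e + t" by blast
    have "e + t + e = (e + e) + t" by (simp only: add_ac)
    then have "u + e = e + t \<or> u + e = t" using t(2) ee by (auto simp: add.commute)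
    then show ?thesis using t(1) subset_sums_insert[OF \<open>e \<notin> B\<close>] by auto
  qed
  show ?thesis
  proof (rule subset_sums_Un_eq_closure)
    show "?A \<subseteq> group_closure S" "?C \<subseteq> group_closure S"
      using subset_sums_subset_closure[of S] subset_sums_mono[of "{e, c, c + e}" S]
        subset_sums_mono[of "{e, - c, - c + e}" S] unfolding S by auto
    show "card (group_closure S) < card ?A + card ?C" using small A6 C6 by simp
    fix u v assume u: "u \<in> ?A" and v: "v \<in> ?C"
    have B: "{c, c + e} \<inter> {e, - c, - c + e} = {}" using ne \<open>c \<noteq> - c\<close> by auto
    have SB: "S = {c, c + e} \<union> {e, - c, - c + e}" unfolding S by auto
    obtain u' where u': "u' \<in> subset_sums {c, c + e}" "u = u' \<or> u = u' + e"
      using u subset_sums_insert[of e "{c, c + e}"] ne by (auto simp: add.commute)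
    have "v + e \<in> ?C" using ecl[OF v] ne by simp
    then have "u' + v \<in> subset_sums S" "u' + (v + e) \<in> subset_sums S"
      using subset_sums_Un[OF B] u' v unfolding SB by blast+
    then show "u + v \<in> subset_sums S" using u' by (auto simp: add_ac)
  qed
qed

text \<open>A nondegenerate triple contributes seven sums and the remaining pair four, unless the pair
  consists of opposite elements; in that case an exchange breaks the pair up.\<close>

lemma subset_sums_eq_closure_card_5:
  fixes S :: "'a::{ab_group_add, finite} set"
  assumes "card S = 5" "0 \<notin> S" "card (group_closure S) \<le> 10"
  shows "subset_sums S = group_closure S"
proof (cases "\<exists>e c. S = {e, c, - c, c + e, - c + e} \<and> e = - e \<and> c \<noteq> - c")
  case True
  then show ?thesis using subset_sums_involution_quintuple assms by blast
next
  case False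
  then obtain x y z where xyz: "x \<in> S" "y \<in> S" "z \<in> S" "x \<noteq> y" "x \<noteq> z" "y \<noteq> z" "\<not> degenerate x y z"
    using nondegenerate_triple_exists[of S] assms by (auto simp: numeral_eq_Suc)
  have fin: ?thesis
    if "x \<in> S" "y \<in> S" "z \<in> S" "x \<noteq> y" "x \<noteq> z" "y \<noteq> z" "\<not> degenerate x y z"
      "S - {x, y, z} = {p, q}" "p \<noteq> q" "p \<noteq> - q" for x y z p q
  proof (rule subset_sums_eq_closure_split)
    show "{x, y, z} \<subseteq> S" using that by simp
    have "7 \<le> card (subset_sums {x, y, z})"
      using that assms by (intro card_subset_sums_nondegenerate_triple) auto
    moreover have "card (subset_sums {p, q}) = 4"
      using that assms by (intro card_subset_sums_pair) auto
    ultimately show "card (group_closure S) < card (subset_sums {x, y, z}) + card (subset_sums (S - {x, y, z}))"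
      using that assms by simp
  qed
  have "card (S - {x, y, z}) = 2" using xyz assms by (simp add: card_Diff_subset)
  then obtain p q where pq: "S - {x, y, z} = {p, q}" "p \<noteq> q" by (auto simp: card_2_iff)
  show ?thesis
  proof (cases "p = - q")
    case False
    then show ?thesis using fin xyz pq by blast
  next
    case True
    have q: "q \<notin> {x, y, z}" "- q \<notin> {x, y, z}" "q \<noteq> - q" using pq True by auto
    obtain x' y' z' where *: "{x', y', z'} = {x, y, z}" "x' \<noteq> y'" "x' \<noteq> z'" "y' \<noteq> z'" "\<not> degenerate x' y' q"
      using nondegenerate_triple_exchange[OF xyz(7,4,5,6) q] by blast
    have "S = {x', y', z'} \<union> (S - {x, y, z})" using xyz(1-3) unfolding *(1) by blast
    then have S: "S = {x', y', z', q, - q}" unfolding pq(1) True by blast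
    have ne: "q \<noteq> x'" "q \<noteq> y'" "q \<noteq> z'" "- q \<noteq> x'" "- q \<noteq> y'" "- q \<noteq> z'" using q unfolding *(1)[symmetric] by auto
    have "S - {x', y', q} = {z', - q}" unfolding S using ne q(3) *(2-4) by blast
    moreover have "z' \<noteq> - (- q)" "z' \<noteq> - q" "x' \<noteq> q" "y' \<noteq> q" using ne by auto
    moreover have "x' \<in> S" "y' \<in> S" "q \<in> S" using S by auto
    ultimately show ?thesis
      using fin[of x' y' q z' "- q"] *(2,5) by blast
  qed
qed

text \<open>Seven sums from a nondegenerate triple and six from its complement exceed twelve. If the
  complement of every nondegenerate triple had fewer than six sums, it would be \<open>{\<plusminus> a, 2a}\<close> or
  a Klein four-group without zero; in both cases exchanging elements leads to a contradiction.\<close>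

lemma subset_sums_eq_closure_card_6:
  fixes S :: "'a::{ab_group_add, finite} set"
  assumes "card S = 6" "0 \<notin> S" "card (group_closure S) \<le> 12"
  shows "subset_sums S = group_closure S"
proof (rule ccontr)
  assume no: "\<not> ?thesis"
  have fin: "card (subset_sums (S - {x, y, z})) < 6"
    if "x \<in> S" "y \<in> S" "z \<in> S" "x \<noteq> y" "x \<noteq> z" "y \<noteq> z" "\<not> degenerate x y z" for x y z
  proof (rule ccontr)
    assume ge: "\<not> ?thesis"
    have "7 \<le> card (subset_sums {x, y, z})"
      using that assms by (intro card_subset_sums_nondegenerate_triple) auto
    then have "subset_sums S = group_closure S"
      using that assms ge by (intro subset_sums_eq_closure_split[of "{x, y, z}"]) auto
    then show False using no by blast
  qed
  have "\<not> (\<exists>e c. S = {e, c, - c, c + e, - c + e} \<and> e = - e \<and> c \<noteq> - c)"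
  proof
    assume "\<exists>e c. S = {e, c, - c, c + e, - c + e} \<and> e = - e \<and> c \<noteq> - c"
    then obtain e c where "S = {e, c, - c, c + e, - c + e}" by blast
    then have "card S \<le> 5" by (simp add: card_insert_if)
    then show False using assms by simp
  qed
  then obtain x y z where xyz: "x \<in> S" "y \<in> S" "z \<in> S" "x \<noteq> y" "x \<noteq> z" "y \<noteq> z" "\<not> degenerate x y z"
    using nondegenerate_triple_exists[of S] assms by auto
  let ?V = "S - {x, y, z}"
  have "card ?V = 3" using xyz assms by (simp add: card_Diff_subset)
  moreover have "0 \<notin> ?V" using assms by simp
  ultimately have "(\<exists>a. ?V = {a, - a, a + a} \<and> a \<noteq> - a) \<or>
      (\<exists>e f. ?V = {e, f, e + f} \<and> (\<forall>v\<in>?V. v = - v))"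
    using fin[OF xyz] by (rule triple_with_few_sums)
  then consider a where "?V = {a, - a, a + a}" "a \<noteq> - a"
    | e f where "?V = {e, f, e + f}" "\<forall>v\<in>?V. v = - v"
    by (elim disjE exE conjE)
  then show False
  proof cases
    case (1 a)
    have V3: "card {a, - a, a + a} = 3" using 1 \<open>card ?V = 3\<close> by simp
    then have aa: "a + a \<noteq> a" "a + a \<noteq> - a" using 1(2) by (auto simp: card_insert_if split: if_splits)
    have mem: "a \<in> S" "- a \<in> S" "a + a \<in> S" using 1(1) by auto
    have nin: "a \<notin> {x, y, z}" "- a \<notin> {x, y, z}" "a + a \<notin> {x, y, z}" using 1(1) by blast+
    have S: "S = {x, y, z, a, - a, a + a}" using 1(1) xyz by auto
    \<comment> \<open>The parts \<open>{p, q, a}\<close> and \<open>{r, - a, 2a}\<close> are large enough unless the first is degenerate or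
      the second contains the opposite elements \<open>r\<close> and \<open>2a\<close>.\<close>
    have key: "degenerate p q a" if "{p, q, r} = {x, y, z}" "p \<noteq> q" "p \<noteq> r" "q \<noteq> r" "r \<noteq> - (a + a)" for p q r
    proof (rule ccontr)
      assume nd: "\<not> ?thesis"
      have ne: "p \<noteq> a" "q \<noteq> a" "r \<noteq> a" "p \<noteq> - a" "q \<noteq> - a" "r \<noteq> - a" "p \<noteq> a + a" "q \<noteq> a + a" "r \<noteq> a + a"
        using nin unfolding that(1)[symmetric] by auto
      have S': "S = {p, q, r, a, - a, a + a}" using S that(1) by auto
      have "S - {p, q, a} = {- a, r, a + a}" unfolding S' using ne that 1(2) aa by auto
      moreover have "6 \<le> card (subset_sums {- a, r, a + a})"
      proof (rule card_subset_sums_asymmetric_triple)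
        show "- a \<noteq> - r" "- a \<noteq> - (a + a)" "- a \<noteq> - (- a)" "- a \<noteq> r" "- a \<noteq> a + a" using ne aa 1(2) by auto
        show "r \<noteq> - (a + a)" "r \<noteq> a + a" using that ne by auto
        show "- a \<noteq> 0" "r \<noteq> 0" "a + a \<noteq> 0" using assms(2) S' by auto
      qed
      ultimately show False using fin[of p q a] S' that ne nd by auto
    qed
    \<comment> \<open>If \<open>r = - 2a\<close>, the split into \<open>{p, r, a}\<close> and \<open>{q, 2a, - a}\<close> has no opposite elements in either part;
      degeneracy of the first then forces \<open>p\<close>, and by symmetry \<open>q\<close>, to be \<open>3a\<close>.\<close>
    have three: "p = a + a + a" if "{p, q, r} = {x, y, z}" "p \<noteq> q" "p \<noteq> r" "q \<noteq> r" "r = - (a + a)" for p q r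
    proof -
      have ne: "p \<noteq> a" "q \<noteq> a" "r \<noteq> a" "p \<noteq> - a" "q \<noteq> - a" "r \<noteq> - a" "p \<noteq> a + a" "q \<noteq> a + a" "r \<noteq> a + a"
        using nin unfolding that(1)[symmetric] by auto
      have "q \<noteq> - (a + a)" using that by auto
      then have deg: "degenerate p r a" using key[of p r q] that by (auto simp: insert_commute)
      have "p \<noteq> - r" using that ne by simp
      have "a \<noteq> - r" "a \<noteq> - p" using ne by auto
      have "(p = - p) \<noteq> (r = - r)"
        using deg 1(2) \<open>p \<noteq> - r\<close> ne that by (intro degenerate_exactly_one_involution) auto
      moreover have "r \<noteq> - r" using ne that by auto
      ultimately have "p = - p" by simp
      then have "a = r + p \<or> a = - r + p"
        using degenerate_involutionD[OF deg] ne that \<open>a \<noteq> - r\<close> by auto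
      then have "p = a - r \<or> p = a + r" by auto
      moreover have "p \<noteq> a + r" using ne that by auto
      ultimately show ?thesis using that by (simp add: add_ac)
    qed
    show False
    proof (cases "- (a + a) \<in> {x, y, z}")
      case False
      obtain p q r where *: "{p, q, r} = {x, y, z}" "p \<noteq> q" "p \<noteq> r" "q \<noteq> r" "\<not> degenerate p q a"
        using nondegenerate_triple_exchange[OF xyz(7,4,5,6) nin(1,2) 1(2)] by blast
      moreover have "r \<noteq> - (a + a)" using False unfolding *(1)[symmetric] by auto
      ultimately show False using key by blast
    next
      case True
      have same: "p = q" if *: "{p, q, r} = {x, y, z}" "p \<noteq> r" "q \<noteq> r" "r = - (a + a)" for p q r
      proof (rule ccontr)
        assume "p \<noteq> q"
        moreover have "{q, p, r} = {x, y, z}" using * by blast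
        ultimately have "p = a + a + a" "q = a + a + a" using three[of p q r] three[of q p r] * by blast+
        then show False using \<open>p \<noteq> q\<close> by simp
      qed
      have "{y, z, x} = {x, y, z}" "{x, z, y} = {x, y, z}" by blast+
      with True show False using same[of x y z] same[of y z x] same[of x z y] xyz(4-6) by blast
    qed
  next
    case (2 e f)
    have V3: "card {e, f, e + f} = 3" using 2 \<open>card ?V = 3\<close> by simp
    \<comment> \<open>The split into \<open>{x, y, g}\<close> and \<open>{z, h, k}\<close> shows that \<open>x, y\<close> are related through each of the three
      involutions; two of these relations carry the same sign.\<close>
    have rel: "y = x + g \<or> y = - x + g" if g: "{g, h, k} = {e, f, e + f}" "g \<noteq> h" "g \<noteq> k" "h \<noteq> k" for g h k
    proof -
      have gV: "{g, h, k} = ?V" using g(1) 2(1) by simp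
      have "S = {x, y, z} \<union> ?V" using xyz(1-3) by blast
      then have S: "S = {x, y, z, g, h, k}" unfolding gV[symmetric] by blast
      have nin: "x \<notin> {g, h, k}" "y \<notin> {g, h, k}" "z \<notin> {g, h, k}" unfolding gV by blast+
      have ginv: "g = - g" "h = - h" "k = - k" using 2(2) unfolding gV[symmetric] by blast+
      have "\<not> card (subset_sums {z, h, k}) < 6"
      proof (cases "z = - z")
        case False
        have "6 \<le> card (subset_sums {z, h, k})"
        proof (rule card_subset_sums_asymmetric_triple)
          show "z \<noteq> - h" "z \<noteq> - k" "z \<noteq> h" "z \<noteq> k" using nin ginv(2,3) by (simp_all flip: ginv(2,3))
          show "h \<noteq> - k" using g(4) by (simp flip: ginv(3))
          show "z \<noteq> 0" "h \<noteq> 0" "k \<noteq> 0" using S assms by auto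
        qed (use False g in auto)
        then show ?thesis by simp
      next
        case True
        have hk: "g = h + k"
        proof -
          have ff: "e + e = 0" "f + f = 0" using 2 by (simp_all add: eq_neg_iff_add_eq_0)
          have "f + (e + f) = e" "e + (e + f) = f" 
            using ff by (metis add.assoc add.commute add.right_neutral)+
          then have sums: "e + f = f + e" "e + (e + f) = f" "f + (e + f) = e" "e + f + e = f" "e + f + f = e"
            by (simp_all add: add_ac)
          have "g \<in> {e, f, e + f}" "h \<in> {e, f, e + f}" "k \<in> {e, f, e + f}" using g(1) by blast+
          then show ?thesis using sums g(2-4) by (elim insertE) simp_all
        qed
        have "\<not> degenerate z h k"
        proof
          assume "degenerate z h k"
          then have "k = h + z \<or> k = - h + z"
            using degenerate_involutionD[of z h k] True nin g(4) ginv(3) by (metis insertCI)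
          then have "k = h + z" using ginv(2) by metis
          then have "h + k = h + h + z" by (simp add: add.assoc)
          moreover have "h + h = 0" using ginv(2) by (simp add: eq_neg_iff_add_eq_0)
          ultimately have "z = h + k" by simp
          then show False using hk nin by simp
        qed
        then have "7 \<le> card (subset_sums {z, h, k})"
          using nin g(4) assms(2) unfolding S by (intro card_subset_sums_nondegenerate_triple) auto
        then show ?thesis by simp
      qed
      moreover have "S - {x, y, g} = {z, h, k}"
        unfolding S using nin xyz(4-6) g(2-4) by blast
      moreover have "g \<in> S" "x \<noteq> g" "y \<noteq> g" unfolding S using nin by blast+
      ultimately have "degenerate x y g"
        using fin[of x y g] xyz(1,2,4) by metis
      then have "degenerate g x y" by (simp add: degenerate_rotate)
      moreover have "x \<noteq> - y" using xyz by (auto simp: degenerate_def)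
      ultimately show ?thesis
        using degenerate_involutionD[of g x y] ginv(1) \<open>x \<noteq> g\<close> \<open>y \<noteq> g\<close> by metis
    qed
    have ne: "e \<noteq> f" "e \<noteq> e + f" "f \<noteq> e + f" using V3 by (auto simp: card_insert_if split: if_splits)
    have "{f, e, e + f} = {e, f, e + f}" "{e + f, e, f} = {e, f, e + f}" by blast+
    then show False
      using rel[of e f "e + f"] rel[of f e "e + f"] rel[of "e + f" e f] ne
      by (metis add_left_cancel)
  qed
qed

text \<open>Seven sums from a nondegenerate triple and eight from the complementary quadruple exceed
  fourteen. The quadruple \<open>{\<plusminus> a, \<plusminus> b}\<close> is avoided by exchanging \<open>a\<close>, since \<open>- a\<close> then lacks
  its opposite.\<close>

lemma subset_sums_eq_closure_card_7:
  fixes S :: "'a::{ab_group_add, finite} set"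
  assumes "card S = 7" "0 \<notin> S" "card (group_closure S) \<le> 14"
  shows "subset_sums S = group_closure S"
proof -
  have fin: ?thesis
    if U: "{x, y, z} \<subseteq> S" "x \<noteq> y" "x \<noteq> z" "y \<noteq> z" "\<not> degenerate x y z"
      and nosym: "\<not> (\<exists>a b. S - {x, y, z} = {a, - a, b, - b} \<and> a \<noteq> - a \<and> b \<noteq> - b \<and> a \<noteq> b \<and> a \<noteq> - b)"
    for x y z
  proof -
    let ?V = "S - {x, y, z}"
    have V: "card ?V = 4" "0 \<notin> ?V" using U assms by (simp_all add: card_Diff_subset)
    have U7: "7 \<le> card (subset_sums {x, y, z})"
      using U assms by (intro card_subset_sums_nondegenerate_triple) auto
    consider "8 \<le> card (subset_sums ?V)" | "subset_sums ?V = group_closure ?V"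
      using card_subset_sums_quadruple[OF V] nosym by blast
    then show ?thesis
    proof cases
      case 1
      then show ?thesis using U U7 assms
        by (intro subset_sums_eq_closure_split[of "{x, y, z}"]) auto
    next
      case 2
      have "5 \<le> card (group_closure ?V)"
        using card_less_card_subset_sums[OF V(2)] V(1) 2 by simp
      then have "card (group_closure S) < 3 * card (group_closure ?V)" using assms(3) by linarith
      with 2 show ?thesis by (rule subset_sums_eq_closure_subgroup[rotated]) blast
    qed
  qed
  have "\<not> (\<exists>e c. S = {e, c, - c, c + e, - c + e} \<and> e = - e \<and> c \<noteq> - c)"
  proof
    assume "\<exists>e c. S = {e, c, - c, c + e, - c + e} \<and> e = - e \<and> c \<noteq> - c"
    then obtain e c where "S = {e, c, - c, c + e, - c + e}" by blast
    then have "card S \<le> 5" by (simp add: card_insert_if)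
    then show False using assms by simp
  qed
  then obtain x y z where xyz: "x \<in> S" "y \<in> S" "z \<in> S" "x \<noteq> y" "x \<noteq> z" "y \<noteq> z" "\<not> degenerate x y z"
    using nondegenerate_triple_exists[of S] assms(1,2) by fastforce
  let ?V = "S - {x, y, z}"
  show ?thesis
  proof (cases "\<exists>a b. ?V = {a, - a, b, - b} \<and> a \<noteq> - a \<and> b \<noteq> - b \<and> a \<noteq> b \<and> a \<noteq> - b")
    case False
    have "{x, y, z} \<subseteq> S" using xyz(1-3) by blast
    then show ?thesis using xyz(4-7) False by (rule fin)
  next
    case True
    then obtain a b where V: "?V = {a, - a, b, - b}" and a: "a \<noteq> - a" by blast
    have nin: "a \<notin> {x, y, z}" "- a \<notin> {x, y, z}" using V by blast+
    obtain p q r where *: "{p, q, r} = {x, y, z}" "p \<noteq> q" "p \<noteq> r" "q \<noteq> r" "\<not> degenerate p q a"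
      using nondegenerate_triple_exchange[OF xyz(7,4,5,6) nin a] by blast
    have pq: "p \<in> {x, y, z}" "q \<in> {x, y, z}" unfolding *(1)[symmetric] by simp_all
    have "a \<in> ?V" "- a \<in> ?V" unfolding V by simp_all
    then have mem: "{p, q, a} \<subseteq> S" using pq xyz(1-3) by blast
    have ne: "p \<noteq> a" "q \<noteq> a" "- a \<notin> {p, q, a}"
      using pq nin not_sym[OF a] by blast+
    show ?thesis
    proof (rule fin[of p q a])
      show "\<not> (\<exists>c d. S - {p, q, a} = {c, - c, d, - d} \<and> c \<noteq> - c \<and> d \<noteq> - d \<and> c \<noteq> d \<and> c \<noteq> - d)"
      proof
        assume "\<exists>c d. S - {p, q, a} = {c, - c, d, - d} \<and> c \<noteq> - c \<and> d \<noteq> - d \<and> c \<noteq> d \<and> c \<noteq> - d"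
        then obtain c d where W: "S - {p, q, a} = {c, - c, d, - d}" by blast
        have "- a \<in> S - {p, q, a}" using ne(3) \<open>- a \<in> ?V\<close> by blast
        then have "a \<in> S - {p, q, a}" unfolding W by auto
        then show False by blast
      qed
    qed (use mem *(2,5) ne(1,2) in simp_all)
  qed
qed

text \<open>The complement of a nondegenerate triple still has five elements, so the induction
  hypothesis applies to it and \<open>7 + 2(|S| - 3) > 2|S|\<close>.\<close>

lemma subset_sums_eq_closure_card_ge_8:
  fixes S :: "'a::{ab_group_add, finite} set"
  assumes "card S \<ge> 8" "0 \<notin> S" and small: "card (group_closure S) \<le> 2 * card S"
    and IH: "\<And>V. V \<subseteq> S \<Longrightarrow> 5 \<le> card V \<Longrightarrow> card V < card S \<Longrightarrow>
      min (card (group_closure V)) (2 * card V) \<le> card (subset_sums V)"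
  shows "subset_sums S = group_closure S"
proof -
  have "\<not> (\<exists>e c. S = {e, c, - c, c + e, - c + e} \<and> e = - e \<and> c \<noteq> - c)"
  proof
    assume "\<exists>e c. S = {e, c, - c, c + e, - c + e} \<and> e = - e \<and> c \<noteq> - c"
    then obtain e c where "S = {e, c, - c, c + e, - c + e}" by blast
    then have "card S \<le> 5" by (simp add: card_insert_if)
    then show False using assms by simp
  qed
  then obtain x y z where xyz: "x \<in> S" "y \<in> S" "z \<in> S" "x \<noteq> y" "x \<noteq> z" "y \<noteq> z" "\<not> degenerate x y z"
    using nondegenerate_triple_exists[of S] assms(1,2) by fastforce
  let ?V = "S - {x, y, z}"
  have V: "card ?V = card S - 3" "0 \<notin> ?V" using xyz assms by (simp_all add: card_Diff_subset)
  have U7: "7 \<le> card (subset_sums {x, y, z})"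
    using xyz assms by (intro card_subset_sums_nondegenerate_triple) auto
  have "min (card (group_closure ?V)) (2 * card ?V) \<le> card (subset_sums ?V)"
    using V assms(1) by (intro IH) auto
  then consider "2 * card ?V \<le> card (subset_sums ?V)" | "card (group_closure ?V) \<le> card (subset_sums ?V)"
    by linarith
  then show ?thesis
  proof cases
    case 1
    then show ?thesis using U7 small V(1) xyz assms(1)
      by (intro subset_sums_eq_closure_split[of "{x, y, z}"]) auto
  next
    case 2
    then have eq: "subset_sums ?V = group_closure ?V"
      by (intro card_seteq) (auto intro: subset_sums_subset_closure[THEN subsetD])
    have "card ?V + 1 \<le> card (group_closure ?V)"
      using card_less_card_subset_sums[OF V(2)] eq by simp
    then have "card (group_closure S) < 3 * card (group_closure ?V)"
      using small V(1) assms(1) by linarith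
    with eq show ?thesis by (rule subset_sums_eq_closure_subgroup[rotated]) blast
  qed
qed

section \<open>The bound for possibly empty sums\<close>

text \<open>Either \<open>x\<close> already lies in the subgroup, or its addition doubles the number of sums.\<close>

lemma card_subset_sums_if_full:
  fixes S :: "'a::{ab_group_add, finite} set"
  assumes "x \<in> S" "0 \<notin> S" and full: "subset_sums (S - {x}) = group_closure (S - {x})"
  shows "subset_sums S = group_closure S \<or> 2 * card S \<le> card (subset_sums S)"
proof (cases "x \<in> group_closure (S - {x})")
  case True
  then have "S \<subseteq> group_closure (S - {x})" using subset_closure[of "S - {x}"] by auto
  then have "group_closure S \<subseteq> subset_sums (S - {x})" unfolding full by (rule group_closure_least)
  then have "group_closure S \<subseteq> subset_sums S" using subset_sums_mono[of "S - {x}" S] by auto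
  then show ?thesis using subset_sums_subset_closure[of S] by auto
next
  case False
  have "card (S - {x}) + 1 \<le> card (subset_sums (S - {x}))"
    using assms by (intro card_less_card_subset_sums) auto
  moreover have "card (S - {x}) + 1 = card S"
    using assms by (metis Suc_eq_plus1 card_Suc_Diff1 finite)
  ultimately show ?thesis using card_subset_sums_outside[OF assms(1) False] by simp
qed

text \<open>The inequality for sums that may be empty, relative to the generated subgroup \<open>H\<close>. If
  \<open>|H| \<le> 2|S|\<close> the pigeonhole lemmas give all of \<open>H\<close>. If \<open>|H| > 2|S|\<close> and the bound fails, some
  \<open>v \<in> S\<close> has two exits, so removing \<open>v\<close> loses at least two sums and contradicts the bound
  for \<open>S - {v}\<close>. For five elements the role of the induction hypothesis is played by the bound on
  quadruples. In its exceptional case \<open>S = {v, \<plusminus> a, \<plusminus> b}\<close>, removing any element other than \<open>v\<close>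
  leaves no set of the exceptional form, so the directions \<open>a, b\<close> have at most one exit. As \<open>v\<close> lies in \<open>\<langle>a, b\<rangle>\<close>
  (it would double the number of sums otherwise), these two directions already suffice.\<close>

lemma card_subset_sums_ge:
  fixes S :: "'a::{ab_group_add, finite} set"
  assumes "5 \<le> card S" "0 \<notin> S"
  shows "min (card (group_closure S)) (2 * card S) \<le> card (subset_sums S)"
  using assms
proof (induction "card S" arbitrary: S rule: less_induct)
  case less
  have IH: "min (card (group_closure V)) (2 * card V) \<le> card (subset_sums V)"
    if "V \<subseteq> S" "5 \<le> card V" "card V < card S" for V
    using less.hyps[of V] that less.prems by auto
  show ?case
  proof (cases "card (group_closure S) \<le> 2 * card S")
    case True
    consider "card S = 5" | "card S = 6" | "card S = 7" | "card S \<ge> 8"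
      using less.prems by linarith
    then have "subset_sums S = group_closure S"
      using subset_sums_eq_closure_card_5[of S] subset_sums_eq_closure_card_6[of S]
        subset_sums_eq_closure_card_7[of S] subset_sums_eq_closure_card_ge_8[of S] IH less.prems True
      by cases auto
    then show ?thesis by simp
  next
    case False
    show ?thesis
    proof (rule ccontr)
      assume "\<not> ?thesis"
      then have lt: "card (subset_sums S) < 2 * card S" by auto
      then have notfull: "subset_sums (S - {x}) \<noteq> group_closure (S - {x})" if "x \<in> S" for x
        using card_subset_sums_if_full[OF that] less.prems False by auto
      have sums2: "2 \<le> card (subset_sums S)"
        using card_less_card_subset_sums[of S] less.prems by simp
      have "S \<noteq> {}" using less.prems by auto
      then obtain x where x: "x \<in> S" by blast
      have "\<not> S \<subseteq> {x, - x}"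
      proof
        assume "S \<subseteq> {x, - x}"
        then have "card S \<le> card {x, - x}" by (intro card_mono) auto
        then show False using less.prems by (simp add: card_insert_if split: if_splits)
      qed
      then obtain y where "y \<in> S" "y \<noteq> x" "y \<noteq> - x" by blast
      then have y: "y \<in> S" "x \<noteq> y" "x \<noteq> - y" by auto
      have "\<exists>v\<in>S. \<not> card (exits (subset_sums S) v) \<le> 1"
      proof (rule ccontr)
        assume "\<not> ?thesis"
        then have "card (group_closure S) \<le> card (subset_sums S) + 1"
          using less.prems x y sums2 by (intro card_closure_le_if_few_exits[of S _ x y]) auto
        then show False using False lt by simp
      qed
      then obtain v where v: "v \<in> S" "\<not> card (exits (subset_sums S) v) \<le> 1" by blast
      have drop: "card (subset_sums (S - {u})) + 2 \<le> card (subset_sums S)"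
        if "u \<in> S" "\<not> card (exits (subset_sums S) u) \<le> 1" for u
        using card_subset_sums_remove[OF that(1)] that(2) by linarith
      have cardV: "card (S - {u}) = card S - 1" if "u \<in> S" for u
        using that by simp
      have "card S = 5"
      proof (rule ccontr)
        assume "card S \<noteq> 5"
        then have "min (card (group_closure (S - {v}))) (2 * card (S - {v})) \<le> card (subset_sums (S - {v}))"
          using less.prems cardV[OF v(1)] by (intro IH) auto
        then have "card (group_closure (S - {v})) \<le> card (subset_sums (S - {v}))"
          using drop[OF v] lt cardV[OF v(1)] by (auto simp: min_def split: if_splits)
        then have "subset_sums (S - {v}) = group_closure (S - {v})"
          by (intro card_seteq) (auto intro: subset_sums_subset_closure[THEN subsetD])
        then show False using notfull v by blast
      qed
      have sym: "\<exists>a b. S - {u} = {a, - a, b, - b} \<and> a \<noteq> - a \<and> b \<noteq> - b \<and> a \<noteq> b \<and> a \<noteq> - b"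
        if "u \<in> S" "\<not> card (exits (subset_sums S) u) \<le> 1" for u
      proof -
        have "card (S - {u}) = 4" "0 \<notin> S - {u}"
          using cardV[OF that(1)] \<open>card S = 5\<close> less.prems by simp_all
        moreover have "\<not> 8 \<le> card (subset_sums (S - {u}))"
          using drop[OF that] lt \<open>card S = 5\<close> by linarith
        ultimately show ?thesis
          using card_subset_sums_quadruple[of "S - {u}"] notfull[OF that(1)] by blast
      qed
      obtain a b where V: "S - {v} = {a, - a, b, - b}" and ab: "a \<noteq> - a" "b \<noteq> - b" "a \<noteq> b" "a \<noteq> - b"
        using sym[OF v] by blast
      have few: "card (exits (subset_sums S) u) \<le> 1" if "u \<in> {a, b}" for u
      proof (rule ccontr)
        assume "\<not> ?thesis"
        moreover have "u \<in> S - {v}" "- u \<in> S - {v}" "u \<noteq> - u" unfolding V using that ab by auto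
        then have u: "u \<in> S" "- u \<in> S - {u}" by auto
        ultimately obtain c d where W: "S - {u} = {c, - c, d, - d}" using sym by blast
        have "u \<in> S - {u}" using u(2) unfolding W by auto
        then show False by blast
      qed
      have cl: "group_closure (S - {v}) \<subseteq> group_closure {a, b}"
        unfolding V using subset_closure[of "{a, b}"] by (intro group_closure_least) auto
      have "a \<in> S" "b \<in> S" using V by blast+
      then have ab0: "0 \<notin> {a, b}" using less.prems by auto
      have "card (group_closure {a, b}) \<le> card (subset_sums S) + 1"
        by (rule card_closure_le_if_few_exits[of _ _ a b]) (use few ab ab0 sums2 in auto)
      moreover have "v \<in> group_closure (S - {v})"
      proof (rule ccontr)
        assume "v \<notin> group_closure (S - {v})"
        then have "card (subset_sums S) = 2 * card (subset_sums (S - {v}))"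
          using v by (intro card_subset_sums_outside)
        moreover have "card (S - {v}) + 1 \<le> card (subset_sums (S - {v}))"
          using less.prems by (intro card_less_card_subset_sums) auto
        ultimately show False using lt cardV[OF v(1)] \<open>card S = 5\<close> by simp
      qed
      then have "S \<subseteq> group_closure {a, b}"
        using cl subset_closure[of "S - {v}"] by auto
      then have "card (group_closure S) \<le> card (group_closure {a, b})"
        by (intro card_mono group_closure_least) auto
      ultimately show False using False lt by simp
    qed
  qed
qed

section \<open>Zero-sum free sets\<close>

text \<open>The Kemperman--Scherk inequality in the case that zero has a unique representation, by
  Dyson's transform: for a suitable \<open>a \<in> A\<close>, the sets \<open>A \<union> (a + B)\<close> and \<open>B \<inter> (A - a)\<close> have the same
  total size, a sumset inside the old one, and a smaller second component.\<close>

lemma card_sumset_ge_if_zero_unique: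
  fixes A B :: "'a::{ab_group_add, finite} set"
  assumes "0 \<in> A" "0 \<in> B" and "\<And>a b. a \<in> A \<Longrightarrow> b \<in> B \<Longrightarrow> a + b = 0 \<Longrightarrow> a = 0 \<and> b = 0"
  shows "card A + card B \<le> card {a + b | a b. a \<in> A \<and> b \<in> B} + 1"
  using assms
proof (induction "card B" arbitrary: A B rule: less_induct)
  case less
  show ?case
  proof (cases "B = {0}")
    case True
    then show ?thesis by simp
  next
    case False
    then obtain b where b: "b \<in> B" "b \<noteq> 0" using less.prems by auto
    have "\<exists>a\<in>A. \<not> (+) a ` B \<subseteq> A"
    proof (rule ccontr)
      assume "\<not> ?thesis"
      then have "0 - b \<in> A"
        using b less.prems by (intro diff_mem_if_translation_closed) auto
      then show False using less.prems(3)[of "- b" b] b by simp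
    qed
    then obtain a where a: "a \<in> A" "\<not> (+) a ` B \<subseteq> A" by blast
    let ?A = "A \<union> (+) a ` B" and ?B = "{b \<in> B. a + b \<in> A}"
    have "(+) a ` B \<inter> A = (+) a ` ?B" by auto
    then have "card ((+) a ` B \<inter> A) = card ?B" by (simp add: card_image)
    then have card_eq: "card ?A + card ?B = card A + card B"
      using card_Un_Int[of A "(+) a ` B"] by (simp add: card_image Int_commute)
    have "?B \<subset> B" using a by auto
    then have "card ?B < card B" by (simp add: psubset_card_mono)
    then have "card ?A + card ?B \<le> card {u + v | u v. u \<in> ?A \<and> v \<in> ?B} + 1"
    proof (rule less.hyps)
      show "0 \<in> ?A" "0 \<in> ?B" using less.prems a by auto
      fix u v assume u: "u \<in> ?A" and v: "v \<in> ?B" and "u + v = 0"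
      show "u = 0 \<and> v = 0"
      proof (cases "u \<in> A")
        case True
        then show ?thesis using less.prems(3) v \<open>u + v = 0\<close> by blast
      next
        case False
        then obtain w where w: "w \<in> B" "u = a + w" using u by blast
        then have "(a + v) + w = 0" using \<open>u + v = 0\<close> by (simp add: add_ac)
        then have "w = 0" using less.prems(3)[of "a + v" w] v w by blast
        then show ?thesis using False w a by simp
      qed
    qed
    moreover have "{u + v | u v. u \<in> ?A \<and> v \<in> ?B} \<subseteq> {a + b | a b. a \<in> A \<and> b \<in> B}"
    proof
      fix t assume "t \<in> {u + v | u v. u \<in> ?A \<and> v \<in> ?B}"
      then obtain u v where t: "t = u + v" "u \<in> ?A" "v \<in> ?B" by blast
      show "t \<in> {a + b | a b. a \<in> A \<and> b \<in> B}"
      proof (cases "u \<in> A")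
        case False
        then obtain w where w: "w \<in> B" "u = a + w" using t by blast
        then have "t = (a + v) + w" using t by (simp add: add_ac)
        then show ?thesis using w t by blast
      qed (use t in blast)
    qed
    then have "card {u + v | u v. u \<in> ?A \<and> v \<in> ?B} \<le> card {a + b | a b. a \<in> A \<and> b \<in> B}"
      by (intro card_mono) auto
    ultimately show ?thesis using card_eq by linarith
  qed
qed

definition zero_sum_free :: "'a::ab_group_add set \<Rightarrow> bool" where
  "zero_sum_free S \<longleftrightarrow> (\<forall>B\<subseteq>S. \<Sum>B = 0 \<longrightarrow> B = {})"

lemma zero_sum_free_mono: "zero_sum_free S \<Longrightarrow> T \<subseteq> S \<Longrightarrow> zero_sum_free T"
  unfolding zero_sum_free_def by blast

lemma zero_sum_freeD: "zero_sum_free S \<Longrightarrow> B \<subseteq> S \<Longrightarrow> B \<noteq> {} \<Longrightarrow> \<Sum>B \<noteq> 0"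
  unfolding zero_sum_free_def by blast

lemma zero_notin_zero_sum_free: "zero_sum_free S \<Longrightarrow> 0 \<notin> S"
  using zero_sum_freeD[of S "{0}"] by auto

lemma asymmetric_zero_sum_free: "zero_sum_free S \<Longrightarrow> x \<in> S \<Longrightarrow> y \<in> S \<Longrightarrow> x \<noteq> y \<Longrightarrow> x \<noteq> - y"
  using zero_sum_freeD[of S "{x, y}"] by auto

text \<open>In a zero-sum free set, \<open>0\<close> is a sum of sums from two disjoint parts only as \<open>0 + 0\<close>, so sizes add up
  almost without loss.\<close>

lemma card_subset_sums_zero_sum_free_split:
  fixes S :: "'a::{ab_group_add, finite} set"
  assumes "zero_sum_free S" "U \<subseteq> S"
  shows "card (subset_sums U) + card (subset_sums (S - U)) \<le> card (subset_sums S) + 1"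
proof -
  have S: "S = U \<union> (S - U)" using assms by auto
  have "card (subset_sums U) + card (subset_sums (S - U)) \<le>
      card {a + b | a b. a \<in> subset_sums U \<and> b \<in> subset_sums (S - U)} + 1"
  proof (rule card_sumset_ge_if_zero_unique)
    fix u v assume "u \<in> subset_sums U" "v \<in> subset_sums (S - U)" and uv: "u + v = 0"
    then obtain B C where B: "B \<subseteq> U" "u = \<Sum>B" and C: "C \<subseteq> S - U" "v = \<Sum>C"
      by (auto simp: subset_sums_def)
    have "\<Sum>(B \<union> C) = u + v" unfolding B(2) C(2) by (rule sum.union_disjoint) (use B C in auto)
    then have "B \<union> C = {}" using zero_sum_freeD[OF assms(1), of "B \<union> C"] B C assms(2) uv by auto
    then show "u = 0 \<and> v = 0" using B C by simp
  qed simp_all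
  moreover have "{a + b | a b. a \<in> subset_sums U \<and> b \<in> subset_sums (S - U)} = subset_sums S"
  proof -
    have "U \<inter> (S - U) = {}" by blast
    from subset_sums_Un[OF this] show ?thesis unfolding S[symmetric] by blast
  qed
  ultimately show ?thesis by simp
qed

lemma card_subset_sums_zero_sum_free_pair:
  fixes S :: "'a::{ab_group_add, finite} set"
  assumes "zero_sum_free S" "card S = 2"
  shows "card (subset_sums S) = 4"
proof -
  obtain a b where S: "S = {a, b}" "a \<noteq> b" using assms by (auto simp: card_2_iff)
  have "a \<noteq> 0" "b \<noteq> 0" "a \<noteq> - b"
    using zero_notin_zero_sum_free[OF assms(1)] asymmetric_zero_sum_free[OF assms(1), of a b] S by auto
  then show ?thesis unfolding S(1) using S(2) by (intro card_subset_sums_pair)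
qed

lemma card_subset_sums_zero_sum_free_triple:
  fixes S :: "'a::{ab_group_add, finite} set"
  assumes S: "zero_sum_free S" "card S = 3"
  shows "6 \<le> card (subset_sums S)"
proof (rule ccontr)
  assume "\<not> ?thesis"
  then have "card (subset_sums S) < 6" by simp
  then consider a where "S = {a, - a, a + a}" "a \<noteq> - a" | e f where "S = {e, f, e + f}" "\<forall>v\<in>S. v = - v"
    using triple_with_few_sums[OF S(2)] zero_notin_zero_sum_free[OF S(1)] by blast
  then show False
  proof cases
    case 1
    then show False using asymmetric_zero_sum_free[OF S(1), of a "- a"] by auto
  next
    case 2
    have "\<Sum>S = e + (f + (e + f))"
      unfolding 2(1) using S(2)[unfolded 2(1)]
      by (subst sum.insert) (auto simp: card_insert_if split: if_splits)
    also have "\<dots> = (e + f) + (e + f)" by (simp only: add_ac)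
    also have "\<dots> = 0" using 2 by (simp add: eq_neg_iff_add_eq_0)
    finally have "\<Sum>S = 0" .
    moreover have "S \<noteq> {}" unfolding 2(1) by blast
    ultimately show False using zero_sum_freeD[OF S(1), of S] by blast
  qed
qed

lemma card_subset_sums_zero_sum_free_quadruple:
  fixes S :: "'a::{ab_group_add, finite} set"
  assumes S: "zero_sum_free S" "card S = 4"
  shows "8 \<le> card (subset_sums S)"
proof -
  obtain x y z where xyz: "x \<in> S" "y \<in> S" "z \<in> S" "x \<noteq> y" "x \<noteq> z" "y \<noteq> z" "\<not> degenerate x y z"
    using nondegenerate_triple_if_asymmetric[OF S(2)] asymmetric_zero_sum_free[OF S(1)] by metis
  have z: "0 \<notin> S" using zero_notin_zero_sum_free[OF S(1)] .
  have "7 \<le> card (subset_sums {x, y, z})"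
    using xyz z by (intro card_subset_sums_nondegenerate_triple) auto
  moreover have "card (S - {x, y, z}) = 1" using xyz S by (simp add: card_Diff_subset)
  then have "2 \<le> card (subset_sums (S - {x, y, z}))"
    using card_less_card_subset_sums[of "S - {x, y, z}"] z by simp
  moreover have "{x, y, z} \<subseteq> S" using xyz by blast
  ultimately show ?thesis
    using card_subset_sums_zero_sum_free_split[OF S(1), of "{x, y, z}"] by linarith
qed

text \<open>For fixed \<open>x\<close> and \<open>y\<close>, two sums of \<open>{x, y, z}\<close> coincide only if \<open>z\<close> is one of \<open>x + y\<close>, \<open>x - y\<close>, \<open>y - x\<close>. The
  last two are opposite, so a zero-sum free set cannot contain both unless they are equal; hence one of the three
  or more candidates for \<open>z\<close> is free of relations.\<close>

lemma zero_sum_free_dissociated_triple: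
  fixes S :: "'a::{ab_group_add, finite} set"
  assumes S: "zero_sum_free S" "5 \<le> card S"
  obtains U where "U \<subseteq> S" "card U = 3" "8 \<le> card (subset_sums U)"
proof -
  obtain T where T: "T \<subseteq> S" "card T = 2"
    using obtain_subset_with_card_n[of 2 S] S(2) by auto
  then obtain x y where xy: "T = {x, y}" "x \<noteq> y" by (auto simp: card_2_iff)
  then have mem: "x \<in> S" "y \<in> S" using T by auto
  have card3: "3 \<le> card (S - {x, y})" using mem xy S(2) by (simp add: card_Diff_subset)
  let ?R = "{x + y, x - y, y - x}"
  have "\<not> S - {x, y} \<subseteq> ?R"
  proof
    assume sub: "S - {x, y} \<subseteq> ?R"
    have R3: "card ?R \<le> 3" by (simp add: card_insert_if)
    then have eq: "S - {x, y} = ?R" using card3 sub by (intro card_seteq) auto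
    then have "card ?R = 3" using card3 R3 by simp
    then have "x - y \<noteq> y - x" by (auto simp: card_insert_if split: if_splits)
    moreover have "x - y \<in> S" "y - x \<in> S" using eq by blast+
    ultimately show False using asymmetric_zero_sum_free[OF S(1), of "x - y" "y - x"] by simp
  qed
  then obtain z where z: "z \<in> S" "z \<noteq> x" "z \<noteq> y" "z \<noteq> x + y" "z \<noteq> x - y" "z \<noteq> y - x" by blast
  have nz: "x \<noteq> 0" "y \<noteq> 0" "z \<noteq> 0"
    using zero_notin_zero_sum_free[OF S(1)] mem z by auto
  have asym: "x \<noteq> - y" "x \<noteq> - z" "y \<noteq> - z"
    using asymmetric_zero_sum_free[OF S(1)] mem z xy by metis+
  have "\<Sum>{x, y, z} \<noteq> 0" by (rule zero_sum_freeD[OF S(1)]) (use mem z in auto)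
  then have sum: "x + y + z \<noteq> 0" using xy z by (auto simp: add.assoc)
  have "exits (subset_sums {x, y}) z = subset_sums {x, y}"
  proof
    show "subset_sums {x, y} \<subseteq> exits (subset_sums {x, y}) z"
    proof (rule ccontr)
      assume "\<not> ?thesis"
      then obtain t where "t \<in> subset_sums {x, y}" "t \<notin> exits (subset_sums {x, y}) z" by blast
      then have "z = x + y \<or> y = x + z \<or> x = y + z \<or> x + y + z = 0"
        using exits_pair_sums[of x y z t] nz asym xy z by blast
      then show False using z(4-6) sum by auto
    qed
  qed (auto simp: exits_def)
  moreover have "card (subset_sums {x, y}) = 4" using nz xy asym by (intro card_subset_sums_pair)
  ultimately have "card (subset_sums {z, x, y}) = 8"
    using card_subset_sums_insert[of z "{x, y}"] z by simp
  then show ?thesis using that[of "{z, x, y}"] mem z xy by simp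
qed

text \<open>Splitting off triples with eight sums: each adds at least seven sums for three elements,
  and the surplus compensates for the two, three or four elements left at the end.\<close>

lemma card_subset_sums_zero_sum_free_ge:
  fixes S :: "'a::{ab_group_add, finite} set"
  assumes "zero_sum_free S" "5 \<le> card S"
  shows "2 * card S + 1 \<le> card (subset_sums S)"
  using assms
proof (induction "card S" arbitrary: S rule: less_induct)
  case less
  obtain U where U: "U \<subseteq> S" "card U = 3" "8 \<le> card (subset_sums U)"
    using zero_sum_free_dissociated_triple[OF less.prems] by blast
  let ?V = "S - U"
  have V: "card ?V = card S - 3" "zero_sum_free ?V"
    using U less.prems zero_sum_free_mono[of S ?V] by (simp_all add: card_Diff_subset)
  have "2 * card S \<le> card (subset_sums ?V) + 6"
  proof -
    consider "card S = 5" | "card S = 6" | "card S = 7" | "card S \<ge> 8"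
      using less.prems by linarith
    then show ?thesis
    proof cases
      case 1
      then show ?thesis using card_subset_sums_zero_sum_free_pair[OF V(2)] V(1) by simp
    next
      case 2
      then show ?thesis using card_subset_sums_zero_sum_free_triple[OF V(2)] V(1) by simp
    next
      case 3
      then show ?thesis using card_subset_sums_zero_sum_free_quadruple[OF V(2)] V(1) by simp
    next
      case 4
      then have "2 * card ?V + 1 \<le> card (subset_sums ?V)"
        using V by (intro less.hyps) auto
      then show ?thesis using V(1) 4 by linarith
    qed
  qed
  then show ?case
    using card_subset_sums_zero_sum_free_split[OF less.prems(1) U(1)] U(3) by linarith
qed

section \<open>Nonempty sums\<close>

theorem theorem5:
  fixes S :: "'a::{ab_group_add, finite} set"
  assumes "generating S"
    and "0 \<notin> S"
    and "card S \<ge> 5"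
  shows "card (nonempty_subset_sums S) \<ge> min (card (UNIV :: 'a set)) (2 * card S)"
proof -
  have ins: "subset_sums S = insert 0 (nonempty_subset_sums S)"
  proof
    show "subset_sums S \<subseteq> insert 0 (nonempty_subset_sums S)"
    proof
      fix t assume "t \<in> subset_sums S"
      then obtain B where "B \<subseteq> S" "t = \<Sum>B" by (auto simp: subset_sums_def)
      then show "t \<in> insert 0 (nonempty_subset_sums S)"
        by (cases "B = {}") (auto simp: nonempty_subset_sums_def)
    qed
    show "insert 0 (nonempty_subset_sums S) \<subseteq> subset_sums S"
      using zero_in_subset_sums[of S] by (auto simp: subset_sums_def nonempty_subset_sums_def)
  qed
  show ?thesis
  proof (cases "0 \<in> nonempty_subset_sums S")
    case True
    then have "subset_sums S = nonempty_subset_sums S" using ins by auto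
    then show ?thesis
      using card_subset_sums_ge[of S] assms by (simp add: generating_def)
  next
    case False
    then have "zero_sum_free S"
      unfolding zero_sum_free_def nonempty_subset_sums_def by (metis (mono_tags, lifting) mem_Collect_eq)
    then have "2 * card S + 1 \<le> card (subset_sums S)"
      using assms(3) by (rule card_subset_sums_zero_sum_free_ge)
    then show ?thesis using ins False by simp
  qed
qed

end
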